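(* Let $(W,S)$ be a finite Coxeter system and $\varphi:W\hookrightarrow\mathrm{Sym}(n)$ ($n\ge 2$) an E-embedding, with borders taken at $\alpha=\pi/4$. Then for every $w\in W$ there is a bijection between $\mathcal{R}_{J_\varphi}(w)$ and $\mathcal{T}_\varphi(w)$; namely, the map sending the equivalence class of a reduced word $s_{i_1}\cdots s_{i_k}$ for $w$ to its tiling $\mathrm{T}_\varphi(s_{i_1}\cdots s_{i_k})$ is well defined and bijective.
   Context: $(W,S)$ is a finite Coxeter system with length $\ell$, $m_{r,s}$ the order of $rs$, reflections $T=\{wsw^{-1}\}$. Right weak order $<_R$: transitive closure of $u<_R us$ ($s\in S$, $\ell(us)=\ell(u)+1$). Bruhat order $<_B$: transitive closure of $u<_B ut$ ($t\in T$, $\ell(ut)=\ell(u)+1$). $\mathrm{Sym}(n)$ = permutations of $\{1,\dots,n\}$ written on the right ($(i)w$ image of $i$; $uv$ = first $u$ then $v$), Coxeter generators $(i,i+1)$, reflections all transpositions. An E-embedding is an injective homomorphism $\varphi:W\to\mathrm{Sym}(n)$ with $u<_R v\Rightarrow\varphi(u)<_B\varphi(v)$. Borders: $\alpha=\pi/4$, $\theta_k=\frac{(k-1)(\pi-2\alpha)}{n-1}+\alpha$, $\beta^k_n=(-\cos\theta_k,\sin\theta_k)$ for $k=1,\dots,n$. For $\sigma\in\mathrm{Sym}(n)$, $p_i(\sigma)=\sum_{j=1}^i\beta_n^{(j)\sigma^{-1}}$ and $\mathrm{B}_n(\sigma)=\bigcup_{i=1}^n[p_{i-1}(\sigma),p_i(\sigma)]\subseteq\mathbb{R}^2$.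 Put $\mathrm{B}_\varphi(w)=\mathrm{B}_n(\varphi(w))$. Tiling: for a reduced expression $s_{i_1}\cdots s_{i_k}$, $\mathrm{T}_\varphi(s_{i_1}\cdots s_{i_k})=\bigcup_{j=0}^k\mathrm{B}_\varphi(s_{i_1}\cdots s_{i_j})\subseteq\mathbb{R}^2$ (the $j=0$ term being $\mathrm{B}_\varphi(\mathrm{id})$). $\mathcal{T}_\varphi(w)$ is the set of all $\mathrm{T}_\varphi(s_{i_1}\cdots s_{i_k})$ over all reduced words $s_{i_1}\cdots s_{i_k}$ for $w$. $J_\varphi$: for distinct $r,s\in S$, $\{r,s\}\in J_\varphi$ iff for every reduced word of the form $x\,\underbrace{srs\cdots}_{m_{s,r}}\,y$ one has $\mathrm{T}_\varphi(x\,\underbrace{srs\cdots}_{m_{s,r}}\,y)=\mathrm{T}_\varphi(x\,\underbrace{rsr\cdots}_{m_{s,r}}\,y)$, where $\underbrace{srs\cdots}_{m}$ is the alternating word of length $m$ starting with $s$. $\mathcal{R}_{J_\varphi}(w)$ is the set of equivalence classes of reduced words for $w$ under the equivalence relation generated by the braid moves $x\,\underbrace{srs\cdots}_{m_{s,r}}\,y\leftrightarrow x\,\underbrace{rsr\cdots}_{m_{s,r}}\,y$ for $\{r,s\}\in J_\varphi$. *)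

theory Defs
  imports "HOL-Analysis.Line_Segment" "HOL-Algebra.Multiplicative_Group"
          "HOL-Combinatorics.Transposition" "HOL-Combinatorics.Permutations"
begin

definition word_eval :: "('a, 'b) monoid_scheme \<Rightarrow> 'a list \<Rightarrow> 'a" where
  "word_eval G ws = foldr (\<lambda>x acc. x \<otimes>\<^bsub>G\<^esub> acc) ws \<one>\<^bsub>G\<^esub>"

definition cox_length :: "('a, 'b) monoid_scheme \<Rightarrow> 'a set \<Rightarrow> 'a \<Rightarrow> nat" where
  "cox_length G S w = (LEAST k. \<exists>ws. set ws \<subseteq> S \<and> length ws = k \<and> word_eval G ws = w)"

definition reduced_word_for :: "('a, 'b) monoid_scheme \<Rightarrow> 'a set \<Rightarrow> 'a list \<Rightarrow> 'a \<Rightarrow> bool" where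
  "reduced_word_for G S ws w \<longleftrightarrow>
     set ws \<subseteq> S \<and> word_eval G ws = w \<and> length ws = cox_length G S w"

definition reduced_word :: "('a, 'b) monoid_scheme \<Rightarrow> 'a set \<Rightarrow> 'a list \<Rightarrow> bool" where
  "reduced_word G S ws \<longleftrightarrow> reduced_word_for G S ws (word_eval G ws)"

definition reduced_words :: "('a, 'b) monoid_scheme \<Rightarrow> 'a set \<Rightarrow> 'a \<Rightarrow> 'a list set" where
  "reduced_words G S w = {ws. reduced_word_for G S ws w}"

definition cox_m :: "('a, 'b) monoid_scheme \<Rightarrow> 'a \<Rightarrow> 'a \<Rightarrow> nat" where
  "cox_m G r s = group.ord G (r \<otimes>\<^bsub>G\<^esub> s)"

definition alt_word :: "'a \<Rightarrow> 'a \<Rightarrow> nat \<Rightarrow> 'a list" where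
  "alt_word s r m = map (\<lambda>i. if even i then s else r) [0..<m]"

text \<open>Congruence on words generated by the Coxeter relations s s = 1 and (r s)^{m_{r,s}} = 1
  (monoid presentation; equivalent to the group presentation since generators are involutions).\<close>
inductive cox_equiv :: "('a, 'b) monoid_scheme \<Rightarrow> 'a set \<Rightarrow> 'a list \<Rightarrow> 'a list \<Rightarrow> bool"
  for G S where
  refl: "cox_equiv G S xs xs"
| sym: "cox_equiv G S xs ys \<Longrightarrow> cox_equiv G S ys xs"
| trans: "cox_equiv G S xs ys \<Longrightarrow> cox_equiv G S ys zs \<Longrightarrow> cox_equiv G S xs zs"
| square: "s \<in> S \<Longrightarrow> cox_equiv G S (u @ [s, s] @ v) (u @ v)"
| coxrel: "r \<in> S \<Longrightarrow> s \<in> S \<Longrightarrow> r \<noteq> s \<Longrightarrow>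
     cox_equiv G S (u @ concat (replicate (cox_m G r s) [r, s]) @ v) (u @ v)"

definition coxeter_system :: "('a, 'b) monoid_scheme \<Rightarrow> 'a set \<Rightarrow> bool" where
  "coxeter_system G S \<longleftrightarrow>
     group G \<and> S \<subseteq> carrier G \<and> \<one>\<^bsub>G\<^esub> \<notin> S \<and>
     (\<forall>s\<in>S. s \<otimes>\<^bsub>G\<^esub> s = \<one>\<^bsub>G\<^esub>) \<and>
     (\<forall>w\<in>carrier G. \<exists>ws. set ws \<subseteq> S \<and> word_eval G ws = w) \<and>
     (\<forall>xs ys. set xs \<subseteq> S \<longrightarrow> set ys \<subseteq> S \<longrightarrow>
        word_eval G xs = word_eval G ys \<longrightarrow> cox_equiv G S xs ys)"

definition finite_coxeter_system :: "('a, 'b) monoid_scheme \<Rightarrow> 'a set \<Rightarrow> bool" where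
  "finite_coxeter_system G S \<longleftrightarrow> coxeter_system G S \<and> finite (carrier G)"

definition reflections :: "('a, 'b) monoid_scheme \<Rightarrow> 'a set \<Rightarrow> 'a set" where
  "reflections G S = {w \<otimes>\<^bsub>G\<^esub> s \<otimes>\<^bsub>G\<^esub> inv\<^bsub>G\<^esub> w | w s. w \<in> carrier G \<and> s \<in> S}"

definition right_weak_step :: "('a, 'b) monoid_scheme \<Rightarrow> 'a set \<Rightarrow> 'a \<Rightarrow> 'a \<Rightarrow> bool" where
  "right_weak_step G S u v \<longleftrightarrow> u \<in> carrier G \<and> (\<exists>s\<in>S. v = u \<otimes>\<^bsub>G\<^esub> s \<and>
      cox_length G S v = cox_length G S u + 1)"

definition right_weak_less :: "('a, 'b) monoid_scheme \<Rightarrow> 'a set \<Rightarrow> 'a \<Rightarrow> 'a \<Rightarrow> bool" where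
  "right_weak_less G S = tranclp (right_weak_step G S)"

definition bruhat_step :: "('a, 'b) monoid_scheme \<Rightarrow> 'a set \<Rightarrow> 'a \<Rightarrow> 'a \<Rightarrow> bool" where
  "bruhat_step G S u v \<longleftrightarrow> u \<in> carrier G \<and> (\<exists>t\<in>reflections G S. v = u \<otimes>\<^bsub>G\<^esub> t \<and>
      cox_length G S v = cox_length G S u + 1)"

definition bruhat_less :: "('a, 'b) monoid_scheme \<Rightarrow> 'a set \<Rightarrow> 'a \<Rightarrow> 'a \<Rightarrow> bool" where
  "bruhat_less G S = tranclp (bruhat_step G S)"

text \<open>Permutations of {1..n}; the product u v means "first u, then v", i.e. the function v \<circ> u.\<close>
definition SymR :: "nat \<Rightarrow> (nat \<Rightarrow> nat) monoid" where
  "SymR n = \<lparr>carrier = {p. p permutes {1..n}}, monoid.mult = (\<lambda>u v. v \<circ> u), monoid.one = id\<rparr>"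

definition sym_gens :: "nat \<Rightarrow> (nat \<Rightarrow> nat) set" where
  "sym_gens n = {Transposition.transpose i (i + 1) | i. 1 \<le> i \<and> i < n}"

definition E_embedding :: "('a, 'b) monoid_scheme \<Rightarrow> 'a set \<Rightarrow> nat \<Rightarrow> ('a \<Rightarrow> nat \<Rightarrow> nat) \<Rightarrow> bool" where
  "E_embedding G S n \<phi> \<longleftrightarrow>
     \<phi> \<in> hom G (SymR n) \<and> inj_on \<phi> (carrier G) \<and>
     (\<forall>u\<in>carrier G. \<forall>v\<in>carrier G. right_weak_less G S u v \<longrightarrow>
         bruhat_less (SymR n) (sym_gens n) (\<phi> u) (\<phi> v))"

definition border_theta :: "real \<Rightarrow> nat \<Rightarrow> nat \<Rightarrow> real" where
  "border_theta \<alpha> n k = (real k - 1) * (pi - 2 * \<alpha>) / (real n - 1) + \<alpha>"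

definition border_beta :: "real \<Rightarrow> nat \<Rightarrow> nat \<Rightarrow> real \<times> real" where
  "border_beta \<alpha> n k = (- cos (border_theta \<alpha> n k), sin (border_theta \<alpha> n k))"

definition border_pt :: "real \<Rightarrow> nat \<Rightarrow> (nat \<Rightarrow> nat) \<Rightarrow> nat \<Rightarrow> real \<times> real" where
  "border_pt \<alpha> n \<sigma> i = (\<Sum>j=1..i. border_beta \<alpha> n (Hilbert_Choice.inv \<sigma> j))"

definition border :: "real \<Rightarrow> nat \<Rightarrow> (nat \<Rightarrow> nat) \<Rightarrow> (real \<times> real) set" where
  "border \<alpha> n \<sigma> = (\<Union>i\<in>{1..n}. closed_segment (border_pt \<alpha> n \<sigma> (i - 1)) (border_pt \<alpha> n \<sigma> i))"

definition border_phi :: "nat \<Rightarrow> ('a \<Rightarrow> nat \<Rightarrow> nat) \<Rightarrow> 'a \<Rightarrow> (real \<times> real) set" where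
  "border_phi n \<phi> w = border (pi / 4) n (\<phi> w)"

definition tiling :: "('a, 'b) monoid_scheme \<Rightarrow> nat \<Rightarrow> ('a \<Rightarrow> nat \<Rightarrow> nat) \<Rightarrow> 'a list \<Rightarrow> (real \<times> real) set" where
  "tiling G n \<phi> ws = (\<Union>j\<in>{0..length ws}. border_phi n \<phi> (word_eval G (take j ws)))"

definition tilings :: "('a, 'b) monoid_scheme \<Rightarrow> 'a set \<Rightarrow> nat \<Rightarrow> ('a \<Rightarrow> nat \<Rightarrow> nat) \<Rightarrow> 'a \<Rightarrow> (real \<times> real) set set" where
  "tilings G S n \<phi> w = tiling G n \<phi> ` reduced_words G S w"

definition J_cond :: "('a, 'b) monoid_scheme \<Rightarrow> 'a set \<Rightarrow> nat \<Rightarrow> ('a \<Rightarrow> nat \<Rightarrow> nat) \<Rightarrow> 'a \<Rightarrow> 'a \<Rightarrow> bool" where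
  "J_cond G S n \<phi> s r \<longleftrightarrow>
     (\<forall>x y. reduced_word G S (x @ alt_word s r (cox_m G s r) @ y) \<longrightarrow>
        tiling G n \<phi> (x @ alt_word s r (cox_m G s r) @ y) =
        tiling G n \<phi> (x @ alt_word r s (cox_m G s r) @ y))"

definition J_phi :: "('a, 'b) monoid_scheme \<Rightarrow> 'a set \<Rightarrow> nat \<Rightarrow> ('a \<Rightarrow> nat \<Rightarrow> nat) \<Rightarrow> 'a set set" where
  "J_phi G S n \<phi> = {{r, s} | r s. r \<in> S \<and> s \<in> S \<and> r \<noteq> s \<and> J_cond G S n \<phi> s r}"

definition J_braid_step :: "('a, 'b) monoid_scheme \<Rightarrow> 'a set set \<Rightarrow> 'a list \<Rightarrow> 'a list \<Rightarrow> bool" where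
  "J_braid_step G J u v \<longleftrightarrow> (\<exists>x y r s. {r, s} \<in> J \<and> r \<noteq> s \<and>
      u = x @ alt_word s r (cox_m G s r) @ y \<and> v = x @ alt_word r s (cox_m G s r) @ y)"

definition R_J :: "('a, 'b) monoid_scheme \<Rightarrow> 'a set \<Rightarrow> 'a set set \<Rightarrow> 'a \<Rightarrow> 'a list set set" where
  "R_J G S J w = reduced_words G S w // {(u, v). equivclp (J_braid_step G J) u v}"

end

theory Submission
  imports Defs
begin

text \<open>
  Every border is a path whose edges \<open>(dx, dy)\<close> satisfy \<open>\<bar>dx\<bar> \<le> dy\<close>, because \<open>\<alpha> = \<pi>/4\<close>; it is thus
  the graph \<open>x = f y\<close> of a 1-Lipschitz function. A Bruhat step moves some of its vertices by a vector
  \<open>\<beta>\<^sup>b - \<beta>\<^sup>a\<close> with \<open>a < b\<close>, which satisfies \<open>\<bar>dy\<bar> < dx\<close>. Hence the borders along a reduced word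
  move weakly to the right, and two of them touch only where their vertices coincide.

  Each generator \<open>s\<close> cuts \<open>{1..n}\<close> into minimal intervals (blocks) stable under \<open>\<phi> s\<close>. Suppose that
  \<open>x s a\<close> and \<open>x b\<close> are reduced words for the same element with the same tiling, and that \<open>r\<close> is a
  letter of \<open>b\<close> before the first \<open>s\<close>. Over a block of \<open>s\<close>, the first curve of the tiling to the right
  of the border of \<open>x\<close> is the border of \<open>x s\<close>. So \<open>r\<close> moves the border there either not at all or in
  exactly the way \<open>s\<close> does, and the latter is impossible since the borders of \<open>1\<close>, \<open>r\<close>, \<open>r s\<close> move to the
  right. So \<open>r\<close> and \<open>s\<close> have disjoint nontrivial blocks; therefore \<open>m\<^sub>r\<^sub>s = 2\<close> and \<open>{r, s} \<in> J\<^sub>\<phi>\<close>. Moving \<open>s\<close>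
  to the front of \<open>b\<close> by braid moves in \<open>J\<^sub>\<phi>\<close>, one concludes by induction on the length.
\<close>

section \<open>The geometry of borders\<close>

lemma theta_range:
  assumes "n \<ge> 2" "k \<in> {1..n}"
  shows "pi/4 \<le> border_theta (pi/4) n k" "border_theta (pi/4) n k \<le> 3*pi/4"
proof -
  define c where "c = (real k - 1) / (real n - 1)"
  have "0 \<le> c" "c \<le> 1"
    using assms by (auto simp: c_def)
  then have "0 \<le> c * (pi/2)" "c * (pi/2) \<le> 1 * (pi/2)"
    by (intro mult_nonneg_nonneg mult_right_mono; simp)+
  moreover have "border_theta (pi/4) n k = c * (pi/2) + pi/4"
    by (simp add: border_theta_def c_def)
  ultimately show "pi/4 \<le> border_theta (pi/4) n k" "border_theta (pi/4) n k \<le> 3*pi/4"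
    by simp_all
qed

lemma theta_strict_mono:
  assumes "n \<ge> 2" "a < b"
  shows "border_theta (pi/4) n a < border_theta (pi/4) n b"
  using assms by (simp add: border_theta_def divide_strict_right_mono)

lemma cos_plus_sin: "cos t + sin t = sqrt 2 * cos (t - pi/4)" for t :: real
  by (simp add: cos_diff cos_45 sin_45 distrib_left mult.left_commute)

lemma cos_minus_sin: "cos t - sin t = sqrt 2 * cos (t + pi/4)" for t :: real
  by (simp add: cos_add cos_45 sin_45 right_diff_distrib mult.left_commute)

text \<open>The strict inequality keeps nonzero vectors of this cone out of the cone |dx| \<le>
  |dy|, in which the chords of a border lie.\<close>

definition right_cone :: "(real \<times> real) set" where
  "right_cone = {v. v = 0 \<or> \<bar>snd v\<bar> < fst v}"

lemma right_cone_0: "0 \<in> right_cone"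
  by (simp add: right_cone_def)

text \<open>Nonzero members have positive first coordinate, so the cone is pointed: two
  displacements to the right never cancel.\<close>

lemma right_cone_add:
  assumes "u \<in> right_cone" "v \<in> right_cone"
  shows "u + v \<in> right_cone" and "u + v = 0 \<longleftrightarrow> u = 0 \<and> v = 0"
  using assms by (auto simp: right_cone_def prod_eq_iff)

lemma right_cone_scale:
  assumes "u \<in> right_cone" "0 \<le> c"
  shows "c *\<^sub>R u \<in> right_cone"
proof (cases "u = 0 \<or> c = 0")
  case False
  then have "c * \<bar>snd u\<bar> < c * fst u" using assms by (auto simp: right_cone_def)
  then show ?thesis using assms by (simp add: right_cone_def abs_mult)
qed (auto simp: right_cone_def)

text \<open>The inequalities compare cos + sin and cos - sin at the two angles, that is, cosines of
  the angles shifted by -pi/4 and pi/4. As \<alpha> = pi/4, the shifted angles stay in [0, pi],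
  where the cosine is strictly decreasing.\<close>

lemma beta_diff_right_cone:
  assumes n: "n \<ge> 2" and ab: "a \<in> {1..n}" "b \<in> {1..n}" "a < b"
  defines "d \<equiv> border_beta (pi/4) n b - border_beta (pi/4) n a"
  shows "d \<in> right_cone" "d \<noteq> 0"
proof -
  let ?s = "border_theta (pi/4) n a" and ?t = "border_theta (pi/4) n b"
  have lt: "?s < ?t" using theta_strict_mono n ab by blast
  note r = theta_range[OF n ab(1)] theta_range[OF n ab(2)]
  have "cos (?t - pi/4) < cos (?s - pi/4)"
    using lt r by (intro cos_monotone_0_pi) auto
  then have 1: "cos ?t + sin ?t < cos ?s + sin ?s" by (simp add: cos_plus_sin)
  have "cos (?t + pi/4) < cos (?s + pi/4)"
    using lt r pi_gt_zero by (intro cos_monotone_0_pi) linarith+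
  then have 2: "cos ?t - sin ?t < cos ?s - sin ?s" by (simp add: cos_minus_sin)
  show "d \<in> right_cone" "d \<noteq> 0" using 1 2
    by (auto simp: d_def right_cone_def border_beta_def abs_less_iff zero_prod_def)
qed

text \<open>The signs come from the same two shifted cosines. The bound by 1 lets the height of one
  edge vector serve as a parameter on another edge in \<open>inv_eq_on_block\<close>.\<close>

lemma beta_timelike:
  assumes n: "n \<ge> 2" and a: "a \<in> {1..n}"
  defines "v \<equiv> border_beta (pi/4) n a"
  shows "\<bar>fst v\<bar> \<le> snd v" "0 < snd v" "snd v \<le> 1"
proof -
  let ?s = "border_theta (pi/4) n a"
  note r = theta_range[OF n a]
  have "0 \<le> cos (?s - pi/4)" using r by (intro cos_ge_zero) auto
  then have 1: "0 \<le> cos ?s + sin ?s" by (simp add: cos_plus_sin)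
  have "0 \<le> cos (pi - (?s + pi/4))" using r by (intro cos_ge_zero) auto
  then have "cos (?s + pi/4) \<le> 0" by (simp only: cos_pi_minus)
  then have 2: "cos ?s - sin ?s \<le> 0" by (simp only: cos_minus_sin) (simp add: mult_nonneg_nonpos)
  show "\<bar>fst v\<bar> \<le> snd v" using 1 2 by (auto simp: v_def border_beta_def abs_le_iff)
  show "0 < snd v" 
  proof -
    have "0 < ?s" "?s < pi" using r pi_gt_zero by linarith+
    then show ?thesis by (simp add: v_def border_beta_def sin_gt_zero)
  qed
  show "snd v \<le> 1" by (simp add: v_def border_beta_def)
qed

text \<open>The first coordinate of the equation says that the sine of the difference of the angles
  vanishes, and these differ by at most pi/2.\<close>

lemma beta_parallel_imp_eq:
  assumes n: "n \<ge> 2" and ab: "a \<in> {1..n}" "b \<in> {1..n}"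
    and eq: "snd (border_beta (pi/4) n b) *\<^sub>R border_beta (pi/4) n a =
             snd (border_beta (pi/4) n a) *\<^sub>R border_beta (pi/4) n b"
  shows "a = b"
proof -
  have no: "\<not> x < y" if xy: "x \<in> {1..n}" "y \<in> {1..n}" and
    eq: "snd (border_beta (pi/4) n y) *\<^sub>R border_beta (pi/4) n x =
             snd (border_beta (pi/4) n x) *\<^sub>R border_beta (pi/4) n y" for x y
  proof
    assume lt: "x < y"
    let ?s = "border_theta (pi/4) n x" and ?t = "border_theta (pi/4) n y"
    have "?s < ?t" using theta_strict_mono n lt by blast
    moreover note theta_range[OF n xy(1)] theta_range[OF n xy(2)]
    ultimately have "0 < sin (?t - ?s)" using pi_gt_zero by (intro sin_gt_zero) linarith+
    moreover have "sin (?t - ?s) = 0" using eq by (simp add: sin_diff border_beta_def)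
    ultimately show False by simp
  qed
  then show ?thesis using no[OF ab eq] no[OF ab(2,1) eq[symmetric]] by simp
qed

section \<open>Vertices of a border\<close>

lemma border_pt_0 [simp]: "border_pt \<alpha> n \<sigma> 0 = 0"
  by (simp add: border_pt_def)

lemma border_pt_Suc:
  "border_pt \<alpha> n \<sigma> (Suc k) = border_pt \<alpha> n \<sigma> k + border_beta \<alpha> n (Hilbert_Choice.inv \<sigma> (Suc k))"
  by (simp add: border_pt_def add.commute)

lemma inv_permutes_mem:
  assumes "\<sigma> permutes {1..n}" "k \<in> {1..n}"
  shows "Hilbert_Choice.inv \<sigma> k \<in> {1..n}"
  using assms permutes_in_image permutes_inv by metis

text \<open>A vertex is a sum of edge vectors, so it depends on the set of the first
  \<open>k\<close> labels but not on their order.\<close>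

lemma border_pt_cong_image:
  assumes "\<sigma> permutes {1..n}" "\<tau> permutes {1..n}"
    "Hilbert_Choice.inv \<tau> ` {1..k} = Hilbert_Choice.inv \<sigma> ` {1..k}"
  shows "border_pt \<alpha> n \<tau> k = border_pt \<alpha> n \<sigma> k"
proof -
  have "border_pt \<alpha> n \<pi> k = (\<Sum>x\<in>Hilbert_Choice.inv \<pi> ` {1..k}. border_beta \<alpha> n x)"
    if "\<pi> permutes {1..n}" for \<pi>
    using permutes_inj_on[OF permutes_inv[OF that]] by (simp add: border_pt_def sum.reindex)
  then show ?thesis using assms by simp
qed

lemma border_pt_n:
  assumes "\<sigma> permutes {1..n}"
  shows "border_pt \<alpha> n \<sigma> n = border_pt \<alpha> n id n"
  using assms permutes_image[OF permutes_inv[OF assms]]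
  by (intro border_pt_cong_image) (auto simp: permutes_id)

lemma border_pt_diff_timelike:
  assumes n: "n \<ge> 2" and s: "\<sigma> permutes {1..n}" and kl: "k \<le> l" "l \<le> n"
  defines "d \<equiv> border_pt (pi/4) n \<sigma> l - border_pt (pi/4) n \<sigma> k"
  shows "\<bar>fst d\<bar> \<le> snd d" "k < l \<Longrightarrow> 0 < snd d"
proof -
  have "\<bar>fst (border_pt (pi/4) n \<sigma> l - border_pt (pi/4) n \<sigma> k)\<bar>
      \<le> snd (border_pt (pi/4) n \<sigma> l - border_pt (pi/4) n \<sigma> k)
    \<and> (k < l \<longrightarrow> 0 < snd (border_pt (pi/4) n \<sigma> l - border_pt (pi/4) n \<sigma> k))"
    using kl
  proof (induction l rule: dec_induct)
    case (step m)
    have "Hilbert_Choice.inv \<sigma> (Suc m) \<in> {1..n}" using inv_permutes_mem[OF s] step by auto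
    note beta_timelike[OF n this]
    with step show ?case by (auto simp: border_pt_Suc)
  qed simp
  then show "\<bar>fst d\<bar> \<le> snd d" "k < l \<Longrightarrow> 0 < snd d" by (auto simp: d_def)
qed

section \<open>Borders as graphs over the height\<close>

definition edge_pt :: "nat \<Rightarrow> (nat \<Rightarrow> nat) \<Rightarrow> nat \<Rightarrow> real \<Rightarrow> real \<times> real" where
  "edge_pt n \<sigma> k t = (1 - t) *\<^sub>R border_pt (pi/4) n \<sigma> (k - 1) + t *\<^sub>R border_pt (pi/4) n \<sigma> k"

lemma mem_border_iff:
  "q \<in> border (pi/4) n \<sigma> \<longleftrightarrow> (\<exists>k\<in>{1..n}. \<exists>t. 0 \<le> t \<and> t \<le> 1 \<and> q = edge_pt n \<sigma> k t)"
  by (auto simp: border_def closed_segment_def edge_pt_def)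

lemma edge_pt_eq:
  assumes "k \<ge> 1"
  shows "edge_pt n \<sigma> k t = border_pt (pi/4) n \<sigma> (k - 1) + t *\<^sub>R border_beta (pi/4) n (Hilbert_Choice.inv \<sigma> k)"
  using assms border_pt_Suc[of "pi/4" n \<sigma> "k - 1"]
  by (simp add: edge_pt_def algebra_simps)

lemma border_pt_mem_border:
  assumes "n \<ge> 1" "k \<le> n"
  shows "border_pt (pi/4) n \<sigma> k \<in> border (pi/4) n \<sigma>"
proof (cases "k = 0")
  case True
  then show ?thesis using assms unfolding mem_border_iff
    by (intro bexI[of _ 1] exI[of _ 0]) (auto simp: edge_pt_def)
next
  case False
  then show ?thesis using assms unfolding mem_border_iff
    by (intro bexI[of _ k] exI[of _ 1]) (auto simp: edge_pt_def)
qed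

text \<open>Between points on different edges the border runs through a piece of an edge, a chain of
  full edges and another piece; each satisfies |dx| \<le> dy, hence so does the sum.\<close>

lemma border_timelike:
  assumes n: "n \<ge> 2" and s: "\<sigma> permutes {1..n}"
    and q: "q \<in> border (pi/4) n \<sigma>" "q' \<in> border (pi/4) n \<sigma>"
  shows "\<bar>fst q - fst q'\<bar> \<le> \<bar>snd q - snd q'\<bar>"
proof -
  have *: "\<bar>fst (edge_pt n \<sigma> l u) - fst (edge_pt n \<sigma> k t)\<bar> \<le> \<bar>snd (edge_pt n \<sigma> l u) - snd (edge_pt n \<sigma> k t)\<bar>"
    if "k \<le> l" "k \<in> {1..n}" "l \<in> {1..n}" "0 \<le> t" "t \<le> 1" "0 \<le> u" "u \<le> 1" for k l t u
  proof -
    let ?bl = "border_beta (pi/4) n (Hilbert_Choice.inv \<sigma> l)"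
    let ?bk = "border_beta (pi/4) n (Hilbert_Choice.inv \<sigma> k)"
    note bl = beta_timelike[OF n inv_permutes_mem[OF s that(3)]]
    note bk = beta_timelike[OF n inv_permutes_mem[OF s that(2)]]
    show ?thesis
    proof (cases "k = l")
      case True
      have "edge_pt n \<sigma> l u - edge_pt n \<sigma> k t = (u - t) *\<^sub>R ?bl"
        using that True by (simp add: edge_pt_eq algebra_simps)
      then have "fst (edge_pt n \<sigma> l u) - fst (edge_pt n \<sigma> k t) = (u - t) * fst ?bl"
        "snd (edge_pt n \<sigma> l u) - snd (edge_pt n \<sigma> k t) = (u - t) * snd ?bl"
        by (simp_all add: prod_eq_iff)
      then show ?thesis using bl by (simp add: abs_mult mult_left_mono)
    next
      case False
      let ?d = "border_pt (pi/4) n \<sigma> (l - 1) - border_pt (pi/4) n \<sigma> k"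
      have d: "\<bar>fst ?d\<bar> \<le> snd ?d"
        using False that by (intro border_pt_diff_timelike[OF n s]) auto
      have k: "border_pt (pi/4) n \<sigma> k = border_pt (pi/4) n \<sigma> (k-1) + ?bk"
        using border_pt_Suc[of "pi/4" n \<sigma> "k - 1"] that by simp
      have "edge_pt n \<sigma> l u - edge_pt n \<sigma> k t = ?d + u *\<^sub>R ?bl + (1 - t) *\<^sub>R ?bk"
        using that by (simp add: edge_pt_eq k algebra_simps)
      then have e: "fst (edge_pt n \<sigma> l u) - fst (edge_pt n \<sigma> k t) = fst ?d + u * fst ?bl + (1 - t) * fst ?bk"
        "snd (edge_pt n \<sigma> l u) - snd (edge_pt n \<sigma> k t) = snd ?d + u * snd ?bl + (1 - t) * snd ?bk"
        by (simp_all add: prod_eq_iff)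
      have "\<bar>u * fst ?bl\<bar> \<le> u * snd ?bl" "\<bar>(1-t) * fst ?bk\<bar> \<le> (1-t) * snd ?bk"
        using bl bk that by (simp_all add: abs_mult mult_left_mono)
      then show ?thesis unfolding e using d by linarith
    qed
  qed
  obtain k t l u where "k \<in> {1..n}" "0 \<le> t" "t \<le> 1" "q = edge_pt n \<sigma> k t"
      "l \<in> {1..n}" "0 \<le> u" "u \<le> 1" "q' = edge_pt n \<sigma> l u"
    using q unfolding mem_border_iff by metis
  then show ?thesis using *[of k l t u] *[of l k u t] by (metis abs_minus_commute nat_le_linear)
qed

text \<open>For a permutation the abscissa is unique at heights in
  \<open>{0..border_height n}\<close>; at other heights the value is unspecified.\<close>

definition border_x :: "nat \<Rightarrow> (nat \<Rightarrow> nat) \<Rightarrow> real \<Rightarrow> real" where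
  "border_x n \<sigma> y = (SOME x. (x, y) \<in> border (pi/4) n \<sigma>)"

lemma ex_edge_at_height:
  assumes n: "n \<ge> 2" and s: "\<sigma> permutes {1..n}" and ij: "i < j" "j \<le> n"
    and y: "snd (border_pt (pi/4) n \<sigma> i) \<le> y" "y \<le> snd (border_pt (pi/4) n \<sigma> j)"
  shows "\<exists>k t. i < k \<and> k \<le> j \<and> 0 \<le> t \<and> t \<le> 1 \<and> snd (edge_pt n \<sigma> k t) = y"
  using ij y
proof (induction j)
  case (Suc j)
  show ?case
  proof (cases "i < j \<and> y \<le> snd (border_pt (pi/4) n \<sigma> j)")
    case True
    then show ?thesis using Suc by (metis le_Suc_eq Suc_leD)
  next
    case False
    then have lo: "snd (border_pt (pi/4) n \<sigma> j) \<le> y" using Suc.prems by (cases "i = j") auto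
    let ?b = "border_beta (pi/4) n (Hilbert_Choice.inv \<sigma> (Suc j))"
    have b: "0 < snd ?b" using Suc.prems by (intro beta_timelike n inv_permutes_mem[OF s]) auto
    define t where "t = (y - snd (border_pt (pi/4) n \<sigma> j)) / snd ?b"
    have "0 \<le> t" "t \<le> 1" using lo b Suc.prems(4) by (auto simp: t_def border_pt_Suc)
    moreover have "snd (edge_pt n \<sigma> (Suc j) t) = y" using b by (simp add: edge_pt_eq t_def)
    ultimately show ?thesis using Suc.prems by (intro exI[of _ "Suc j"] exI[of _ t]) auto
  qed
qed simp

text \<open>The identity is only a representative: by \<open>border_pt_n\<close> all borders end at
  the same vertex.\<close>

abbreviation border_height :: "nat \<Rightarrow> real" where
  "border_height n \<equiv> snd (border_pt (pi/4) n id n)"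

lemma border_pt_height:
  assumes "n \<ge> 2" "\<sigma> permutes {1..n}" "k \<le> n"
  shows "snd (border_pt (pi/4) n \<sigma> k) \<in> {0..border_height n}"
  using border_pt_diff_timelike(1)[OF assms(1,2), of 0 k] border_pt_diff_timelike(1)[OF assms(1,2), of k n] assms
    border_pt_n[OF assms(2), of "pi/4"] by auto

lemma border_height_mem:
  assumes "n \<ge> 2" "\<sigma> permutes {1..n}" "q \<in> border (pi/4) n \<sigma>"
  shows "snd q \<in> {0..border_height n}"
proof -
  obtain k t where k: "k \<in> {1..n}" "0 \<le> t" "t \<le> 1" "q = edge_pt n \<sigma> k t"
    using assms unfolding mem_border_iff by auto
  have "convex {0..border_height n}" by simp
  then have "(1 - t) *\<^sub>R snd (border_pt (pi/4) n \<sigma> (k-1)) + t *\<^sub>R snd (border_pt (pi/4) n \<sigma> k) \<in> {0..border_height n}"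
    using k border_pt_height[OF assms(1,2)] by (intro convexD) auto
  then show ?thesis using k by (simp add: edge_pt_def)
qed

lemma border_x_mem:
  assumes n: "n \<ge> 2" and s: "\<sigma> permutes {1..n}" and y: "y \<in> {0..border_height n}"
  shows "(border_x n \<sigma> y, y) \<in> border (pi/4) n \<sigma>"
proof -
  obtain k t where "0 < k" "k \<le> n" "0 \<le> t" "t \<le> 1" "snd (edge_pt n \<sigma> k t) = y"
    using ex_edge_at_height[OF n s, of 0 n y] y border_pt_n[OF s, of "pi/4"] n by auto
  then have "(fst (edge_pt n \<sigma> k t), y) \<in> border (pi/4) n \<sigma>"
    unfolding mem_border_iff by (intro bexI[of _ k] exI[of _ t]) auto
  then show ?thesis unfolding border_x_def by (rule someI)
qed

lemma mem_border_iff_border_x: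
  assumes n: "n \<ge> 2" and s: "\<sigma> permutes {1..n}"
  shows "(x, y) \<in> border (pi/4) n \<sigma> \<longleftrightarrow> y \<in> {0..border_height n} \<and> x = border_x n \<sigma> y"
proof
  assume q: "(x, y) \<in> border (pi/4) n \<sigma>"
  then have y: "y \<in> {0..border_height n}" using border_height_mem[OF n s q] by simp
  show "y \<in> {0..border_height n} \<and> x = border_x n \<sigma> y"
    using y border_timelike[OF n s q border_x_mem[OF n s y]] by simp
qed (use border_x_mem[OF n s] in auto)

lemma continuous_on_border_x:
  assumes n: "n \<ge> 2" and s: "\<sigma> permutes {1..n}"
  shows "continuous_on {0..border_height n} (border_x n \<sigma>)"
  unfolding continuous_on_iff dist_real_def
proof (intro ballI allI impI)
  fix y e :: real assume y: "y \<in> {0..border_height n}" "0 < e"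
  show "\<exists>d>0. \<forall>z\<in>{0..border_height n}. \<bar>z - y\<bar> < d \<longrightarrow> \<bar>border_x n \<sigma> z - border_x n \<sigma> y\<bar> < e"
    using y border_timelike[OF n s border_x_mem[OF n s] border_x_mem[OF n s y(1)]]
    by (intro exI[of _ e]) force
qed

section \<open>The left-to-right order on borders\<close>

text \<open>Distinct sets of edge vectors may have equal sums, so equality of vertices alone does not give
  equality of label sets; the second conjunct records it along Bruhat steps.\<close>

definition border_le :: "nat \<Rightarrow> (nat \<Rightarrow> nat) \<Rightarrow> (nat \<Rightarrow> nat) \<Rightarrow> bool" where
  "border_le n \<sigma> \<tau> \<longleftrightarrow> (\<forall>k\<le>n. border_pt (pi/4) n \<tau> k - border_pt (pi/4) n \<sigma> k \<in> right_cone \<and>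
     (border_pt (pi/4) n \<tau> k = border_pt (pi/4) n \<sigma> k \<longrightarrow>
        Hilbert_Choice.inv \<tau> ` {1..k} = Hilbert_Choice.inv \<sigma> ` {1..k}))"

lemma border_le_refl: "border_le n \<sigma> \<sigma>"
  by (simp add: border_le_def right_cone_0)

text \<open>The two displacements of vertex \<open>k\<close> lie in the pointed cone and add up to
  zero, so both vanish.\<close>

lemma border_le_antisym_pt:
  assumes "border_le n \<sigma> \<tau>" "border_le n \<tau> \<pi>" "k \<le> n"
    "border_pt (pi/4) n \<pi> k = border_pt (pi/4) n \<sigma> k"
  shows "border_pt (pi/4) n \<tau> k = border_pt (pi/4) n \<sigma> k"
proof -
  let ?u = "border_pt (pi/4) n \<tau> k - border_pt (pi/4) n \<sigma> k"
  let ?v = "border_pt (pi/4) n \<pi> k - border_pt (pi/4) n \<tau> k"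
  have "?u \<in> right_cone" "?v \<in> right_cone" using assms by (auto simp: border_le_def)
  moreover have "?u + ?v = 0" using assms by simp
  ultimately have "?u = 0" using right_cone_add(2) by blast
  then show ?thesis by simp
qed

lemma border_le_trans:
  assumes "border_le n \<sigma> \<tau>" "border_le n \<tau> \<pi>"
  shows "border_le n \<sigma> \<pi>"
  unfolding border_le_def
proof (intro allI impI conjI)
  fix k assume k: "k \<le> n"
  let ?u = "border_pt (pi/4) n \<tau> k - border_pt (pi/4) n \<sigma> k"
  let ?v = "border_pt (pi/4) n \<pi> k - border_pt (pi/4) n \<tau> k"
  have "?u + ?v \<in> right_cone" using assms k by (intro right_cone_add) (auto simp: border_le_def)
  then show "border_pt (pi/4) n \<pi> k - border_pt (pi/4) n \<sigma> k \<in> right_cone" by simp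
  assume eq: "border_pt (pi/4) n \<pi> k = border_pt (pi/4) n \<sigma> k"
  note border_le_antisym_pt[OF assms k eq]
  with eq assms k show "Hilbert_Choice.inv \<pi> ` {1..k} = Hilbert_Choice.inv \<sigma> ` {1..k}"
    by (simp add: border_le_def)
qed

text \<open>At a fixed edge parameter the displacement is a convex combination of those of the two
  end vertices. As the cone is pointed, it vanishes only if every summand of positive weight
  does.\<close>

lemma edge_pt_diff_right_cone:
  assumes "border_le n \<sigma> \<tau>" "k \<in> {1..n}" "0 \<le> t" "t \<le> 1"
  shows "edge_pt n \<tau> k t - edge_pt n \<sigma> k t \<in> right_cone"
    "edge_pt n \<tau> k t = edge_pt n \<sigma> k t \<Longrightarrow>
      (t < 1 \<longrightarrow> border_pt (pi/4) n \<tau> (k-1) = border_pt (pi/4) n \<sigma> (k-1)) \<and>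
      (0 < t \<longrightarrow> border_pt (pi/4) n \<tau> k = border_pt (pi/4) n \<sigma> k)"
proof -
  let ?u = "border_pt (pi/4) n \<tau> (k-1) - border_pt (pi/4) n \<sigma> (k-1)"
  let ?v = "border_pt (pi/4) n \<tau> k - border_pt (pi/4) n \<sigma> k"
  have "?u \<in> right_cone" "?v \<in> right_cone" using assms by (auto simp: border_le_def)
  then have uv: "(1 - t) *\<^sub>R ?u \<in> right_cone" "t *\<^sub>R ?v \<in> right_cone"
    using assms right_cone_scale by auto
  have e: "edge_pt n \<tau> k t - edge_pt n \<sigma> k t = (1 - t) *\<^sub>R ?u + t *\<^sub>R ?v"
    by (simp add: edge_pt_def algebra_simps)
  show "edge_pt n \<tau> k t - edge_pt n \<sigma> k t \<in> right_cone"
    unfolding e using right_cone_add(1)[OF uv] .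
  assume "edge_pt n \<tau> k t = edge_pt n \<sigma> k t"
  then have "(1 - t) *\<^sub>R ?u = 0 \<and> t *\<^sub>R ?v = 0"
    using e right_cone_add(2)[OF uv] by simp
  then show "(t < 1 \<longrightarrow> border_pt (pi/4) n \<tau> (k-1) = border_pt (pi/4) n \<sigma> (k-1)) \<and>
      (0 < t \<longrightarrow> border_pt (pi/4) n \<tau> k = border_pt (pi/4) n \<sigma> k)" by auto
qed

text \<open>The point of \<open>\<sigma>\<close> with the same edge parameter lies to the left of
  \<open>edge_pt n \<tau> k t\<close>, inside the cone in which no other point of the border of \<open>\<sigma>\<close> can lie.\<close>

lemma border_x_le_edge_pt:
  assumes n: "n \<ge> 2" and s: "\<sigma> permutes {1..n}" and le: "border_le n \<sigma> \<tau>"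
    and k: "k \<in> {1..n}" "0 \<le> t" "t \<le> 1" and y: "snd (edge_pt n \<tau> k t) \<in> {0..border_height n}"
  shows "border_x n \<sigma> (snd (edge_pt n \<tau> k t)) \<le> fst (edge_pt n \<tau> k t)"
    "border_x n \<sigma> (snd (edge_pt n \<tau> k t)) = fst (edge_pt n \<tau> k t) \<Longrightarrow>
      edge_pt n \<tau> k t = edge_pt n \<sigma> k t"
proof -
  have "edge_pt n \<sigma> k t \<in> border (pi/4) n \<sigma>" using k mem_border_iff by blast
  note border_timelike[OF n s border_x_mem[OF n s y] this]
  moreover note edge_pt_diff_right_cone(1)[OF le k]
  ultimately show "border_x n \<sigma> (snd (edge_pt n \<tau> k t)) \<le> fst (edge_pt n \<tau> k t)"
    "border_x n \<sigma> (snd (edge_pt n \<tau> k t)) = fst (edge_pt n \<tau> k t) \<Longrightarrow>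
      edge_pt n \<tau> k t = edge_pt n \<sigma> k t"
    by (auto simp: right_cone_def prod_eq_iff)
qed

section \<open>Comparing ordered borders at a given height\<close>

lemma border_x_mono:
  assumes n: "n \<ge> 2" and s: "\<sigma> permutes {1..n}" and t: "\<tau> permutes {1..n}"
    and le: "border_le n \<sigma> \<tau>" and y: "y \<in> {0..border_height n}"
  shows "border_x n \<sigma> y \<le> border_x n \<tau> y"
proof -
  obtain k u where k: "k \<in> {1..n}" "0 \<le> u" "u \<le> 1" and e: "edge_pt n \<tau> k u = (border_x n \<tau> y, y)"
    using border_x_mem[OF n t y] unfolding mem_border_iff by metis
  show ?thesis using border_x_le_edge_pt(1)[OF n s le k] y e by simp
qed

text \<open>The displacement of vertex \<open>k\<close> joins two points of the border of
  \<open>\<tau>\<close>, so it satisfies |dx| \<le> |dy|; in the right cone only zero does.\<close>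

lemma border_pt_eq_if_common:
  assumes n: "n \<ge> 2" and t: "\<tau> permutes {1..n}" and le: "border_le n \<sigma> \<tau>"
    and k: "k \<le> n" and mem: "border_pt (pi/4) n \<sigma> k \<in> border (pi/4) n \<tau>"
  shows "border_pt (pi/4) n \<tau> k = border_pt (pi/4) n \<sigma> k"
proof -
  have "border_pt (pi/4) n \<tau> k - border_pt (pi/4) n \<sigma> k \<in> right_cone"
    using le k by (simp add: border_le_def)
  moreover have "border_pt (pi/4) n \<tau> k \<in> border (pi/4) n \<tau>"
    using n k by (intro border_pt_mem_border) auto
  note border_timelike[OF n t this mem]
  ultimately show ?thesis by (auto simp: right_cone_def)
qed

text \<open>Touching at height \<open>y\<close> would make points of equal edge parameter coincide,
  and with them a vertex strictly between \<open>i\<close> and \<open>j\<close>.\<close>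

lemma border_x_less_in_block:
  assumes n: "n \<ge> 2" and s: "\<sigma> permutes {1..n}" and t: "\<tau> permutes {1..n}"
    and le: "border_le n \<sigma> \<tau>" and ij: "Suc i < j" "j \<le> n"
    and ne: "\<And>k. i < k \<Longrightarrow> k < j \<Longrightarrow> border_pt (pi/4) n \<tau> k \<noteq> border_pt (pi/4) n \<sigma> k"
    and y: "snd (border_pt (pi/4) n \<tau> i) < y" "y < snd (border_pt (pi/4) n \<tau> j)"
  shows "border_x n \<sigma> y < border_x n \<tau> y"
proof -
  have yr: "y \<in> {0..border_height n}"
    using y border_pt_height[OF n t, of i] border_pt_height[OF n t, of j] ij by simp
  obtain k u where k: "i < k" "k \<le> j" "0 \<le> u" "u \<le> 1" "snd (edge_pt n \<tau> k u) = y"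
    using ex_edge_at_height[OF n t, of i j y] ij y by auto
  have kn: "k \<in> {1..n}" using k ij by auto
  have "edge_pt n \<tau> k u \<in> border (pi/4) n \<tau>" using kn k mem_border_iff by blast
  then have x: "fst (edge_pt n \<tau> k u) = border_x n \<tau> y"
    using mem_border_iff_border_x[OF n t, of "fst (edge_pt n \<tau> k u)" y] k(5) by (metis prod.collapse)
  have "edge_pt n \<tau> k u \<noteq> edge_pt n \<sigma> k u"
  proof
    assume "edge_pt n \<tau> k u = edge_pt n \<sigma> k u"
    note eq = edge_pt_diff_right_cone(2)[OF le kn k(3,4) this]
    \<comment> \<open>Parameter 0 on the lowest edge or 1 on the highest would put \<open>y\<close>
      at an end of the height interval. A parameter strictly between 0 and 1 forces
      \<open>k - 1 = i\<close> and \<open>k = j\<close>, against \<open>Suc i < j\<close>.\<close>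
    have "u \<noteq> 0 \<or> k - 1 \<noteq> i" using k(5) y(1) by (auto simp: edge_pt_def)
    moreover have "u \<noteq> 1 \<or> k \<noteq> j" using k(5) y(2) by (auto simp: edge_pt_def)
    moreover have "u < 1 \<longrightarrow> k - 1 = i" using eq ne[of "k - 1"] k by force
    moreover have "0 < u \<longrightarrow> k = j" using eq ne[of k] k by force
    ultimately show False using k ij by linarith
  qed
  with border_x_le_edge_pt[OF n s le kn k(3,4)] k(5) yr x show ?thesis by force
qed

lemma border_x_cong_block:
  assumes n: "n \<ge> 2" and s: "\<sigma> permutes {1..n}" and t: "\<tau> permutes {1..n}" and ij: "i < j" "j \<le> n"
    and eq: "\<And>k. i \<le> k \<Longrightarrow> k \<le> j \<Longrightarrow> border_pt (pi/4) n \<tau> k = border_pt (pi/4) n \<sigma> k"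
    and y: "snd (border_pt (pi/4) n \<tau> i) \<le> y" "y \<le> snd (border_pt (pi/4) n \<tau> j)"
  shows "border_x n \<sigma> y = border_x n \<tau> y"
proof -
  obtain k u where k: "i < k" "k \<le> j" "0 \<le> u" "u \<le> 1" "snd (edge_pt n \<tau> k u) = y"
    using ex_edge_at_height[OF n t ij y] by auto
  have kn: "k \<in> {1..n}" using k ij by auto
  have "edge_pt n \<tau> k u \<in> border (pi/4) n \<tau>" "edge_pt n \<sigma> k u \<in> border (pi/4) n \<sigma>"
    using kn k mem_border_iff by blast+
  moreover have "edge_pt n \<sigma> k u = edge_pt n \<tau> k u" using eq[of k] eq[of "k - 1"] k
    by (simp add: edge_pt_def)
  ultimately show ?thesis
    using mem_border_iff_border_x[OF n t, of "fst (edge_pt n \<tau> k u)" y] k(5)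
      mem_border_iff_border_x[OF n s, of "fst (edge_pt n \<tau> k u)" y] by (metis prod.collapse)
qed

text \<open>The graph determines the edges one after the other: the next two edges start at the same
  vertex and the graphs agree above it, so the edge vectors are parallel and the labels
  equal.\<close>

lemma inv_eq_on_block:
  assumes n: "n \<ge> 2" and s: "\<sigma> permutes {1..n}" and t: "\<tau> permutes {1..n}" and j: "j \<le> n"
    and start: "border_pt (pi/4) n \<tau> i = border_pt (pi/4) n \<sigma> i"
    and eq: "\<And>y. y \<in> {snd (border_pt (pi/4) n \<tau> i)..snd (border_pt (pi/4) n \<tau> j)} \<Longrightarrow>
      border_x n \<sigma> y = border_x n \<tau> y"
    and m: "i < m" "m \<le> j"
  shows "Hilbert_Choice.inv \<sigma> m = Hilbert_Choice.inv \<tau> m"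
proof -
  have "(i < l \<longrightarrow> Hilbert_Choice.inv \<sigma> l = Hilbert_Choice.inv \<tau> l) \<and>
      border_pt (pi/4) n \<tau> l = border_pt (pi/4) n \<sigma> l" if "i \<le> l" "l \<le> j" for l
    using that
  proof (induction l rule: dec_induct)
    case base
    then show ?case using start by simp
  next
    case (step l)
    let ?a = "Hilbert_Choice.inv \<sigma> (Suc l)" and ?b = "Hilbert_Choice.inv \<tau> (Suc l)"
    let ?A = "border_beta (pi/4) n ?a" and ?B = "border_beta (pi/4) n ?b"
    have l: "Suc l \<in> {1..n}" using step j by auto
    have P: "border_pt (pi/4) n \<tau> l = border_pt (pi/4) n \<sigma> l" using step by simp
    have mem: "?a \<in> {1..n}" "?b \<in> {1..n}" using inv_permutes_mem s t l by blast+
    note A = beta_timelike[OF n mem(1)] and B = beta_timelike[OF n mem(2)]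
    \<comment> \<open>Both edges are probed at one height: parameter \<open>snd ?B\<close> along
      \<open>?A\<close> and parameter \<open>snd ?A\<close> along \<open>?B\<close> rise by the same
      amount.\<close>
    define y where "y = snd (border_pt (pi/4) n \<tau> l) + snd ?A * snd ?B"
    have e1: "edge_pt n \<sigma> (Suc l) (snd ?B) = border_pt (pi/4) n \<tau> l + snd ?B *\<^sub>R ?A"
      and e2: "edge_pt n \<tau> (Suc l) (snd ?A) = border_pt (pi/4) n \<tau> l + snd ?A *\<^sub>R ?B"
      using P by (simp_all add: edge_pt_eq)
    have "edge_pt n \<sigma> (Suc l) (snd ?B) \<in> border (pi/4) n \<sigma>"
      unfolding mem_border_iff using A B l by (intro bexI[of _ "Suc l"] exI[of _ "snd ?B"]) auto
    then have x1: "fst (edge_pt n \<sigma> (Suc l) (snd ?B)) = border_x n \<sigma> y"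
      using mem_border_iff_border_x[OF n s, of "fst (edge_pt n \<sigma> (Suc l) (snd ?B))" y] e1
      by (simp add: y_def mult.commute prod_eq_iff plus_prod_def)
    have "edge_pt n \<tau> (Suc l) (snd ?A) \<in> border (pi/4) n \<tau>"
      unfolding mem_border_iff using A B l by (intro bexI[of _ "Suc l"] exI[of _ "snd ?A"]) auto
    then have x2: "fst (edge_pt n \<tau> (Suc l) (snd ?A)) = border_x n \<tau> y"
      using mem_border_iff_border_x[OF n t, of "fst (edge_pt n \<tau> (Suc l) (snd ?A))" y] e2
      by (simp add: y_def mult.commute prod_eq_iff plus_prod_def)
    have "snd (border_pt (pi/4) n \<tau> i) \<le> snd (border_pt (pi/4) n \<tau> l)"
      "snd (border_pt (pi/4) n \<tau> (Suc l)) \<le> snd (border_pt (pi/4) n \<tau> j)"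
      using border_pt_diff_timelike(1)[OF n t, of i l] border_pt_diff_timelike(1)[OF n t, of "Suc l" j] step j by auto
    moreover have "snd ?A * snd ?B \<le> snd ?B" "0 \<le> snd ?A * snd ?B" using A B by (simp_all add: mult_le_cancel_right1)
    ultimately have "border_x n \<sigma> y = border_x n \<tau> y"
      by (intro eq) (auto simp: y_def border_pt_Suc)
    with x1 x2 e1 e2 have "snd ?B *\<^sub>R ?A = snd ?A *\<^sub>R ?B"
      by (simp add: prod_eq_iff)
    then have "?a = ?b" using beta_parallel_imp_eq[OF n mem] by blast
    then show ?case using P by (simp add: border_pt_Suc)
  qed
  then show ?thesis using m by simp
qed

section \<open>Bruhat steps in the symmetric group\<close>

lemma word_eval_Nil [simp]: "word_eval G [] = \<one>\<^bsub>G\<^esub>"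
  and word_eval_Cons [simp]: "word_eval G (x # xs) = x \<otimes>\<^bsub>G\<^esub> word_eval G xs"
  by (simp_all add: word_eval_def)

lemma cox_length_le:
  assumes "set ws \<subseteq> S"
  shows "cox_length G S (word_eval G ws) \<le> length ws"
  unfolding cox_length_def using assms by (intro Least_le) auto

lemma cox_length_attained:
  assumes "set ws \<subseteq> S"
  obtains vs where "set vs \<subseteq> S" "word_eval G vs = word_eval G ws"
    "length vs = cox_length G S (word_eval G ws)"
proof -
  have "\<exists>vs. set vs \<subseteq> S \<and> length vs = cox_length G S (word_eval G ws) \<and> word_eval G vs = word_eval G ws"
    unfolding cox_length_def
    by (rule LeastI_ex) (use assms in auto)
  then show ?thesis using that by blast
qed

lemma SymR_simps [simp]: "carrier (SymR n) = {p. p permutes {1..n}}"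
  "u \<otimes>\<^bsub>SymR n\<^esub> v = v \<circ> u" "\<one>\<^bsub>SymR n\<^esub> = id"
  by (simp_all add: SymR_def)

lemma group_SymR: "group (SymR n)"
proof (rule groupI)
  show "\<exists>q\<in>carrier (SymR n). q \<otimes>\<^bsub>SymR n\<^esub> p = \<one>\<^bsub>SymR n\<^esub>" if "p \<in> carrier (SymR n)" for p
    using that permutes_inv permutes_inv_o(1) by (intro bexI[of _ "Hilbert_Choice.inv p"]) auto
qed (auto simp: permutes_id intro: permutes_compose)

lemma inv_SymR:
  assumes "p permutes {1..n}"
  shows "inv\<^bsub>SymR n\<^esub> p = Hilbert_Choice.inv p"
  using assms permutes_inv permutes_inv_o(1)
  by (intro group.inv_equality[OF group_SymR]) auto

lemma word_eval_SymR_append: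
  "word_eval (SymR n) (us @ vs) = word_eval (SymR n) vs \<circ> word_eval (SymR n) us"
  by (induction us) auto

lemma sym_gens_permutes: "set ws \<subseteq> sym_gens n \<Longrightarrow> word_eval (SymR n) ws permutes {1..n}"
  by (induction ws) (auto simp: permutes_id sym_gens_def intro!: permutes_compose permutes_swap_id)

lemma reflection_SymR:
  assumes "t \<in> reflections (SymR n) (sym_gens n)"
  obtains i j where "1 \<le> i" "i < j" "j \<le> n" "t = Transposition.transpose i j"
proof -
  obtain w k where w: "w permutes {1..n}" and k: "1 \<le> k" "k < n"
    and t: "t = Hilbert_Choice.inv w \<circ> (Transposition.transpose k (k+1) \<circ> w)"
    using assms by (auto simp: reflections_def sym_gens_def inv_SymR)
  let ?w = "Hilbert_Choice.inv w"
  have wi: "?w permutes {1..n}" using w by (rule permutes_inv)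
  have "t = Transposition.transpose (?w k) (?w (k+1))"
    unfolding t using transpose_comp_eq[of w k "k+1"] permutes_bij[OF w]
    by (simp add: fun_eq_iff transpose_apply_commute permutes_inverses[OF w])
  moreover have "?w k \<noteq> ?w (k+1)" using permutes_inj[OF wi] by (metis injD n_not_Suc_n Suc_eq_plus1)
  moreover have "?w k \<in> {1..n}" "?w (k+1) \<in> {1..n}" using k permutes_in_image[OF wi] by auto
  ultimately show thesis using that[of "?w k" "?w (k+1)"] that[of "?w (k+1)" "?w k"]
    by (metis atLeastAtMost_iff linorder_neqE_nat transpose_commute)
qed

lemma transpose_word:
  assumes "1 \<le> i" "i < j" "j \<le> n"
  shows "\<exists>ws. set ws \<subseteq> sym_gens n \<and> word_eval (SymR n) ws = Transposition.transpose i j"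
proof -
  have "Suc i \<le> j" using assms by simp
  then show ?thesis using assms(3)
  proof (induction j rule: dec_induct)
    case base
    then show ?case using assms by (intro exI[of _ "[Transposition.transpose i (i+1)]"]) (auto simp: sym_gens_def)
  next
    case (step m)
    then obtain ws where ws: "set ws \<subseteq> sym_gens n" "word_eval (SymR n) ws = Transposition.transpose i m"
      by auto
    let ?g = "Transposition.transpose m (m+1)"
    have "?g \<in> sym_gens n" using step assms by (auto simp: sym_gens_def)
    moreover have "word_eval (SymR n) ([?g] @ ws @ [?g]) = Transposition.transpose i (Suc m)"
      using transpose_comp_triple[of "Suc m" i m] step
      by (simp only: word_eval_SymR_append ws) (simp add: transpose_commute o_assoc)
    ultimately show ?case using ws by (intro exI[of _ "[?g] @ ws @ [?g]"]) auto
  qed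
qed

text \<open>\<open>cox_length\<close> is a least number, known to be attained only for elements
  represented by some word; \<open>bruhat_stepD\<close> needs such a word.\<close>

lemma permutes_word:
  assumes "u permutes {1..n}"
  shows "\<exists>ws. set ws \<subseteq> sym_gens n \<and> word_eval (SymR n) ws = u"
  using assms finite_atLeastAtMost
proof (induction rule: permutes_induct)
  case (swap a b p)
  then obtain ws where ws: "set ws \<subseteq> sym_gens n" "word_eval (SymR n) ws = p" by auto
  have "\<exists>vs. set vs \<subseteq> sym_gens n \<and> word_eval (SymR n) vs = Transposition.transpose a b"
    using transpose_word[of a b n] transpose_word[of b a n] swap
    by (metis atLeastAtMost_iff linorder_neqE_nat transpose_commute)
  then obtain vs where "set vs \<subseteq> sym_gens n" "word_eval (SymR n) vs = Transposition.transpose a b" by auto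
  then show ?case using ws by (intro exI[of _ "ws @ vs"]) (auto simp: word_eval_SymR_append)
qed (auto intro: exI[of _ "[]"])

text \<open>Strong exchange: the labels at positions \<open>i\<close> and \<open>j\<close> start in increasing order,
  so some letter of the word swaps them, and that letter may be deleted.\<close>

lemma SymR_exchange:
  assumes "set ws \<subseteq> sym_gens n" "i < j"
    "Hilbert_Choice.inv (word_eval (SymR n) ws) j < Hilbert_Choice.inv (word_eval (SymR n) ws) i"
  shows "\<exists>vs. set vs \<subseteq> sym_gens n \<and> length vs + 1 = length ws \<and>
    word_eval (SymR n) vs = Transposition.transpose i j \<circ> word_eval (SymR n) ws"
  using assms
proof (induction ws arbitrary: i j rule: rev_induct)
  case Nil
  then show ?case by simp
next
  case (snoc g ws)
  let ?u = "word_eval (SymR n) ws"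
  obtain k where g: "g = Transposition.transpose k (k+1)"
    using snoc.prems by (auto simp: sym_gens_def)
  have e: "word_eval (SymR n) (ws @ [g]) = g \<circ> ?u" by (simp add: word_eval_SymR_append)
  have "bij ?u" using snoc.prems sym_gens_permutes[of ws n] permutes_bij by auto
  then have inv: "Hilbert_Choice.inv (g \<circ> ?u) = Hilbert_Choice.inv ?u \<circ> g"
    by (simp add: g o_inv_distrib)
  show ?case
  proof (cases "i = k \<and> j = k + 1")
    case True
    then have "?u = Transposition.transpose i j \<circ> word_eval (SymR n) (ws @ [g])"
      unfolding e by (simp add: g fun_eq_iff)
    moreover have "set ws \<subseteq> sym_gens n" using snoc.prems(1) by simp
    ultimately show ?thesis by (metis Suc_eq_plus1 length_append_singleton)
  next
    case False
    \<comment> \<open>The last letter keeps the order of \<open>i\<close> and \<open>j\<close>, so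
      the inversion is already present in \<open>ws\<close>, at positions \<open>g i\<close> and
      \<open>g j\<close>.\<close>
    then have "g i < g j" using snoc.prems(2) by (auto simp: g Transposition.transpose_def)
    moreover have "Hilbert_Choice.inv ?u (g j) < Hilbert_Choice.inv ?u (g i)"
      using snoc.prems(3) unfolding e inv by simp
    ultimately obtain vs where vs: "set vs \<subseteq> sym_gens n" "length vs + 1 = length ws"
      "word_eval (SymR n) vs = Transposition.transpose (g i) (g j) \<circ> ?u"
      using snoc.IH[of "g i" "g j"] snoc.prems(1) by (metis le_sup_iff set_append)
    have "Transposition.transpose i j \<circ> g = g \<circ> Transposition.transpose (g i) (g j)"
      using transpose_comp_eq[of g i j] by (simp add: g)
    then have "word_eval (SymR n) (vs @ [g]) = Transposition.transpose i j \<circ> (g \<circ> ?u)"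
      by (simp add: word_eval_SymR_append vs o_assoc)
    then show ?thesis using vs snoc.prems(1) e by (intro exI[of _ "vs @ [g]"]) auto
  qed
qed

text \<open>Were the labels of \<open>u\<close> at \<open>i\<close> and \<open>j\<close> in
  decreasing order, strong exchange would write \<open>v\<close> with fewer letters than
  \<open>u\<close>, against the increase in length.\<close>

lemma bruhat_stepD:
  assumes "bruhat_step (SymR n) (sym_gens n) u v"
  obtains i j where "1 \<le> i" "i < j" "j \<le> n" "v = Transposition.transpose i j \<circ> u"
    "Hilbert_Choice.inv u i < Hilbert_Choice.inv u j"
proof -
  from assms obtain t where u: "u permutes {1..n}" and t: "t \<in> reflections (SymR n) (sym_gens n)"
    and v: "v = t \<circ> u" and len: "cox_length (SymR n) (sym_gens n) v = cox_length (SymR n) (sym_gens n) u + 1"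
    by (auto simp: bruhat_step_def)
  from t obtain i j where ij: "1 \<le> i" "i < j" "j \<le> n" "t = Transposition.transpose i j"
    by (rule reflection_SymR)
  have "\<not> Hilbert_Choice.inv u j < Hilbert_Choice.inv u i"
  proof
    assume less: "Hilbert_Choice.inv u j < Hilbert_Choice.inv u i"
    obtain ws0 where "set ws0 \<subseteq> sym_gens n" "word_eval (SymR n) ws0 = u"
      using permutes_word[OF u] by auto
    then obtain ws where ws: "set ws \<subseteq> sym_gens n" "word_eval (SymR n) ws = u"
      "length ws = cox_length (SymR n) (sym_gens n) u"
      using cox_length_attained[of ws0 "sym_gens n" "SymR n"] by metis
    then obtain vs where "set vs \<subseteq> sym_gens n" "length vs + 1 = length ws" "word_eval (SymR n) vs = v"
      using SymR_exchange[of ws n i j] less ij v by auto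
    then show False using cox_length_le[of vs "sym_gens n" "SymR n"] ws len by simp
  qed
  moreover have "Hilbert_Choice.inv u i \<noteq> Hilbert_Choice.inv u j"
    using permutes_inj[OF permutes_inv[OF u]] ij by (metis injD less_irrefl)
  ultimately show thesis using that[of i j] ij v by simp
qed

text \<open>For \<open>k\<close> outside \<open>i \<le> k < j\<close> the first \<open>k\<close>
  positions carry the same labels. Inside, the label at \<open>i\<close> gives way to the larger one
  at \<open>j\<close>, which moves the vertex by a nonzero vector of the right cone.\<close>

lemma border_le_transpose:
  assumes n: "n \<ge> 2" and u: "u permutes {1..n}" and ij: "1 \<le> i" "i < j" "j \<le> n"
    and less: "Hilbert_Choice.inv u i < Hilbert_Choice.inv u j"
  shows "border_le n u (Transposition.transpose i j \<circ> u)"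
  unfolding border_le_def
proof (intro allI impI)
  let ?t = "Transposition.transpose i j" and ?v = "Transposition.transpose i j \<circ> u"
  let ?a = "Hilbert_Choice.inv u"
  fix k assume k: "k \<le> n"
  have v: "?v permutes {1..n}" using ij by (intro permutes_compose[OF u] permutes_swap_id) auto
  have inv: "Hilbert_Choice.inv ?v = ?a \<circ> ?t"
    using permutes_bij[OF u] by (simp add: o_inv_distrib)
  show "border_pt (pi/4) n ?v k - border_pt (pi/4) n u k \<in> right_cone \<and>
      (border_pt (pi/4) n ?v k = border_pt (pi/4) n u k \<longrightarrow> Hilbert_Choice.inv ?v ` {1..k} = ?a ` {1..k})"
  proof (cases "i \<le> k \<and> k < j")
    case False
    then have "?t ` {1..k} = {1..k}" using ij by (intro transpose_image_eq) auto
    then have im: "Hilbert_Choice.inv ?v ` {1..k} = ?a ` {1..k}" by (metis inv image_comp)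
    then show ?thesis using border_pt_cong_image[OF u v im] right_cone_0 by simp
  next
    case True
    let ?b = "border_beta (pi/4) n"
    have "border_pt (pi/4) n ?v k = ?b (?a j) + (\<Sum>l\<in>{1..k} - {i}. ?b (?a (?t l)))"
      using True ij unfolding border_pt_def inv by (subst sum.remove[of _ i]) auto
    also have "(\<Sum>l\<in>{1..k} - {i}. ?b (?a (?t l))) = (\<Sum>l\<in>{1..k} - {i}. ?b (?a l))"
      using True by (intro sum.cong) auto
    finally have 1: "border_pt (pi/4) n ?v k = ?b (?a j) + (\<Sum>l\<in>{1..k} - {i}. ?b (?a l))" .
    have 2: "border_pt (pi/4) n u k = ?b (?a i) + (\<Sum>l\<in>{1..k} - {i}. ?b (?a l))"
      using True ij unfolding border_pt_def by (subst sum.remove[of _ i]) auto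
    have "?a i \<in> {1..n}" "?a j \<in> {1..n}" using inv_permutes_mem[OF u] ij by auto
    note beta_diff_right_cone[OF n this less]
    then show ?thesis using 1 2 by auto
  qed
qed

lemma bruhat_less_border_le:
  assumes n: "n \<ge> 2" and "bruhat_less (SymR n) (sym_gens n) u v"
  shows "border_le n u v"
proof -
  have step: "border_le n x y" if "bruhat_step (SymR n) (sym_gens n) x y" for x y
    using that by (elim bruhat_stepD) (use that n border_le_transpose in \<open>auto simp: bruhat_step_def\<close>)
  show ?thesis using assms(2) unfolding bruhat_less_def
    by (induction rule: tranclp_induct) (auto intro: step border_le_trans)
qed

section \<open>E-embeddings and tilings\<close>

locale e_embedded_coxeter = group G for G :: "('a, 'b) monoid_scheme" (structure) +
  fixes S :: "'a set" and n :: nat and \<phi> :: "'a \<Rightarrow> nat \<Rightarrow> nat"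
  assumes cox: "coxeter_system G S" and n2: "n \<ge> 2" and emb: "E_embedding G S n \<phi>"
begin

abbreviation ev :: "'a list \<Rightarrow> 'a" where "ev \<equiv> word_eval G"
abbreviation pt :: "'a \<Rightarrow> nat \<Rightarrow> real \<times> real" where "pt u k \<equiv> border_pt (pi/4) n (\<phi> u) k"
abbreviation bx :: "'a \<Rightarrow> real \<Rightarrow> real" where "bx u y \<equiv> border_x n (\<phi> u) y"

section \<open>Reduced words and their images under the embedding\<close>

lemma S_carrier: "s \<in> S \<Longrightarrow> s \<in> carrier G"
  and S_ne_one: "s \<in> S \<Longrightarrow> s \<noteq> \<one>"
  and S_square: "s \<in> S \<Longrightarrow> s \<otimes> s = \<one>"
  using cox by (auto simp: coxeter_system_def)

lemma ev_closed [simp]: "set ws \<subseteq> S \<Longrightarrow> ev ws \<in> carrier G"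
  by (induction ws) (auto simp: S_carrier)

lemma ev_append: "set us \<subseteq> S \<Longrightarrow> set vs \<subseteq> S \<Longrightarrow> ev (us @ vs) = ev us \<otimes> ev vs"
  by (induction us) (auto simp: S_carrier m_assoc)

lemma ev_snoc: "set us \<subseteq> S \<Longrightarrow> s \<in> S \<Longrightarrow> ev (us @ [s]) = ev us \<otimes> s"
  by (simp add: ev_append S_carrier)

text \<open>Both relations delete an even number of letters. Parity is what shows below that one
  letter, or two distinct ones, form a reduced word.\<close>

lemma cox_equiv_parity: "cox_equiv G S xs ys \<Longrightarrow> even (length xs) \<longleftrightarrow> even (length ys)"
proof (induction rule: cox_equiv.induct)
  case (coxrel r s u v)
  have "length (concat (replicate k [r, s])) = 2 * k" for k by (induction k) auto
  then show ?case by simp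
qed auto

lemma ev_parity:
  "set xs \<subseteq> S \<Longrightarrow> set ys \<subseteq> S \<Longrightarrow> ev xs = ev ys \<Longrightarrow> even (length xs) \<longleftrightarrow> even (length ys)"
  using cox cox_equiv_parity by (simp add: coxeter_system_def)

lemma reduced_wordI:
  assumes "set ws \<subseteq> S"
    "\<And>vs. set vs \<subseteq> S \<Longrightarrow> ev vs = ev ws \<Longrightarrow> length ws \<le> length vs"
  shows "reduced_word G S ws"
proof -
  obtain vs where "set vs \<subseteq> S" "ev vs = ev ws" "length vs = cox_length G S (ev ws)"
    using cox_length_attained[OF assms(1)] by blast
  moreover from this have "length ws \<le> length vs" using assms(2) by blast
  ultimately show ?thesis using assms(1) cox_length_le[OF assms(1), of G]
    by (simp add: reduced_word_def reduced_word_for_def)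
qed

lemma reduced_wordD:
  assumes "reduced_word G S ws"
  shows "set ws \<subseteq> S" "cox_length G S (ev ws) = length ws"
    "set vs \<subseteq> S \<Longrightarrow> ev vs = ev ws \<Longrightarrow> length ws \<le> length vs"
  using assms cox_length_le[of vs S G] by (auto simp: reduced_word_def reduced_word_for_def)

lemma reduced_prefix:
  assumes "reduced_word G S (us @ vs)"
  shows "reduced_word G S us"
proof (rule reduced_wordI)
  have sub: "set us \<subseteq> S" "set vs \<subseteq> S" using reduced_wordD(1)[OF assms] by auto
  show "set us \<subseteq> S" by fact
  fix ws assume ws: "set ws \<subseteq> S" "ev ws = ev us"
  then have "length (us @ vs) \<le> length (ws @ vs)"
    using sub by (intro reduced_wordD(3)[OF assms]) (auto simp: ev_append)
  then show "length us \<le> length ws" by simp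
qed

lemma reduced_same_ev:
  assumes "reduced_word G S us" "set vs \<subseteq> S" "ev vs = ev us" "length vs = length us"
  shows "reduced_word G S vs"
  using assms reduced_wordD(3)[OF assms(1)] by (intro reduced_wordI) auto

lemma reduced_letter: "s \<in> S \<Longrightarrow> reduced_word G S [s]"
proof (rule reduced_wordI)
  fix vs assume "s \<in> S" "set vs \<subseteq> S" "ev vs = ev [s]"
  then show "length [s] \<le> length vs" using ev_parity[of vs "[s]"] by (cases vs) auto
qed auto

lemma reduced_pair:
  assumes "r \<in> S" "s \<in> S" "r \<noteq> s"
  shows "reduced_word G S [r, s]"
proof (rule reduced_wordI)
  fix vs assume vs: "set vs \<subseteq> S" "ev vs = ev [r, s]"
  have "r \<otimes> s \<noteq> s \<otimes> s" using assms S_carrier by simp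
  then have "ev [r, s] \<noteq> \<one>" using S_square S_carrier assms by simp
  then have "vs \<noteq> []" using vs by auto
  moreover have "even (length vs)" using ev_parity[OF vs(1), of "[r, s]"] vs assms by auto
  ultimately show "length [r, s] \<le> length vs" by (cases vs) (auto simp: numeral_2_eq_2 Suc_le_eq)
qed (use assms in auto)

lemma phi_permutes: "u \<in> carrier G \<Longrightarrow> \<phi> u permutes {1..n}"
  using emb by (auto simp: E_embedding_def hom_def)

lemma phi_mult: "u \<in> carrier G \<Longrightarrow> v \<in> carrier G \<Longrightarrow> \<phi> (u \<otimes> v) = \<phi> v \<circ> \<phi> u"
  using emb by (auto simp: E_embedding_def hom_def)

lemma phi_inj: "u \<in> carrier G \<Longrightarrow> v \<in> carrier G \<Longrightarrow> \<phi> u = \<phi> v \<Longrightarrow> u = v"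
  using emb by (auto simp: E_embedding_def inj_on_def)

lemma phi_one: "\<phi> \<one> = id"
proof -
  have "\<phi> \<one> \<circ> \<phi> \<one> = \<phi> \<one>" using phi_mult[of \<one> \<one>] by simp
  then have "\<phi> \<one> (\<phi> \<one> k) = \<phi> \<one> k" for k by (metis comp_apply)
  then show ?thesis using permutes_inj[OF phi_permutes[of \<one>]] by (auto simp: fun_eq_iff dest: injD)
qed

lemma phi_involution: "s \<in> S \<Longrightarrow> \<phi> s \<circ> \<phi> s = id"
  using phi_mult[of s s] S_square[of s] phi_one S_carrier by simp

lemma phi_involution_apply [simp]: "s \<in> S \<Longrightarrow> \<phi> s (\<phi> s k) = k"
  using phi_involution by (metis comp_apply id_apply)

lemma inv_phi_mult:
  assumes "u \<in> carrier G" "s \<in> S"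
  shows "Hilbert_Choice.inv (\<phi> (u \<otimes> s)) = Hilbert_Choice.inv (\<phi> u) \<circ> \<phi> s"
proof -
  have "Hilbert_Choice.inv (\<phi> s) = \<phi> s"
    using phi_involution[OF assms(2)] by (intro inv_unique_comp)
  moreover have "bij (\<phi> s)" "bij (\<phi> u)" using assms phi_permutes S_carrier permutes_bij by blast+
  ultimately show ?thesis using assms S_carrier by (simp add: phi_mult o_inv_distrib)
qed

text \<open>Appending a letter to a reduced word is a weak-order step, which \<open>\<phi>\<close>
  turns into a Bruhat relation and hence into a move to the right.\<close>

lemma reduced_border_le_snoc:
  assumes "reduced_word G S (us @ [s])"
  shows "border_le n (\<phi> (ev us)) (\<phi> (ev (us @ [s])))"
proof -
  have S: "set us \<subseteq> S" "s \<in> S" using reduced_wordD(1)[OF assms] by auto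
  have "right_weak_step G S (ev us) (ev (us @ [s]))"
    using S reduced_wordD(2)[OF assms] reduced_wordD(2)[OF reduced_prefix[OF assms]]
    by (auto simp: right_weak_step_def ev_snoc)
  then have "right_weak_less G S (ev us) (ev (us @ [s]))" by (simp add: right_weak_less_def)
  then have "bruhat_less (SymR n) (sym_gens n) (\<phi> (ev us)) (\<phi> (ev (us @ [s])))"
    using emb S by (simp add: E_embedding_def)
  then show ?thesis using bruhat_less_border_le[OF n2] by blast
qed

lemma reduced_border_le:
  "reduced_word G S (us @ vs) \<Longrightarrow> border_le n (\<phi> (ev us)) (\<phi> (ev (us @ vs)))"
proof (induction vs rule: rev_induct)
  case (snoc s vs)
  have red: "reduced_word G S ((us @ vs) @ [s])" using snoc.prems by simp
  show ?case using border_le_trans[OF snoc.IH[OF reduced_prefix[OF red]] reduced_border_le_snoc[OF red]] by simp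
qed (simp add: border_le_refl)

section \<open>Blocks of a generator, delimited by the \<open>k\<close> with
  \<open>stab s k\<close>\<close>

definition stab :: "'a \<Rightarrow> nat \<Rightarrow> bool" where
  "stab s k \<longleftrightarrow> \<phi> s ` {1..k} = {1..k}"

lemma stab_0: "stab s 0" by (simp add: stab_def)

lemma stab_n: "s \<in> S \<Longrightarrow> stab s n"
  using permutes_image[OF phi_permutes] S_carrier by (simp add: stab_def)

lemma pt_mult_stab:
  assumes "u \<in> carrier G" "s \<in> S" "stab s k"
  shows "pt (u \<otimes> s) k = pt u k"
proof (rule border_pt_cong_image)
  show "Hilbert_Choice.inv (\<phi> (u \<otimes> s)) ` {1..k} = Hilbert_Choice.inv (\<phi> u) ` {1..k}"
    unfolding inv_phi_mult[OF assms(1,2)] image_comp[symmetric] using assms(3) by (simp add: stab_def)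
qed (use assms phi_permutes S_carrier in auto)

text \<open>The label clause of \<open>border_le\<close> turns equal vertices into equal label sets,
  from which the injective labelling of \<open>u\<close> cancels.\<close>

lemma stab_if_pt_eq:
  assumes "u \<in> carrier G" "s \<in> S" "k \<le> n" "border_le n (\<phi> u) (\<phi> (u \<otimes> s))" "pt (u \<otimes> s) k = pt u k"
  shows "stab s k"
proof -
  let ?a = "Hilbert_Choice.inv (\<phi> u)"
  have "Hilbert_Choice.inv (\<phi> (u \<otimes> s)) ` {1..k} = ?a ` {1..k}"
    using assms by (auto simp: border_le_def)
  then have "?a ` (\<phi> s ` {1..k}) = ?a ` {1..k}" by (simp only: inv_phi_mult[OF assms(1,2)] image_comp)
  moreover have "inj ?a" using permutes_inj permutes_inv phi_permutes assms(1) by blast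
  ultimately show ?thesis unfolding stab_def by (metis inj_image_eq_iff)
qed

lemma stab_image_diff:
  assumes "s \<in> S" "stab s i" "stab s j"
  shows "\<phi> s ` ({1..j} - {1..i}) = {1..j} - {1..i}"
  using assms image_set_diff[of "\<phi> s"] permutes_inj[OF phi_permutes] S_carrier by (simp add: stab_def)

lemma stab_block_mem:
  assumes "s \<in> S" "stab s i" "stab s j" "i < l" "l \<le> j"
  shows "i < \<phi> s l \<and> \<phi> s l \<le> j"
proof -
  have "\<phi> s l \<in> \<phi> s ` ({1..j} - {1..i})" using assms by auto
  then have "\<phi> s l \<in> {1..j} - {1..i}" using stab_image_diff[OF assms(1-3)] by simp
  then show ?thesis by auto
qed

lemma stab_fixes:
  assumes "s \<in> S" "stab s (k - 1)" "stab s k" "1 \<le> k"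
  shows "\<phi> s k = k"
  using stab_block_mem[OF assms(1-3), of k] assms(4) by auto

lemma stab_Suc:
  assumes "stab s i" "\<phi> s (Suc i) = Suc i"
  shows "stab s (Suc i)"
  using assms by (simp add: stab_def atLeastAtMostSuc_conv)

text \<open>The ends are the nearest stable positions on either side of \<open>k\<close>; they exist
  because 0 and \<open>n\<close> are stable.\<close>

lemma block_around:
  assumes "s \<in> S" "k \<le> n" "\<not> stab s k"
  obtains i j where "i < k" "k < j" "j \<le> n" "stab s i" "stab s j"
    "\<And>l. i < l \<Longrightarrow> l < j \<Longrightarrow> \<not> stab s l"
proof -
  define i where "i = (GREATEST i. i \<le> k \<and> stab s i)"
  define j where "j = (LEAST j. k \<le> j \<and> stab s j)"
  have i: "i \<le> k \<and> stab s i" unfolding i_def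
    by (rule GreatestI_nat[where b = k and k = 0]) (auto simp: stab_0)
  have j: "k \<le> j \<and> stab s j" unfolding j_def
    by (rule LeastI[of _ n]) (use assms stab_n in auto)
  have "j \<le> n" unfolding j_def by (rule Least_le) (use assms stab_n in auto)
  moreover have "\<not> stab s l" if "i < l" "l < j" for l
  proof
    assume st: "stab s l"
    show False
    proof (cases "l \<le> k")
      case True
      then have "l \<le> i" unfolding i_def using st by (intro Greatest_le_nat[where b = k]) auto
      then show False using that by simp
    next
      case False
      then have "j \<le> l" unfolding j_def using st by (intro Least_le) auto
      then show False using that by simp
    qed
  qed
  ultimately show thesis using that[of i j] i j assms(3) by (metis order_le_imp_less_or_eq)
qed

text \<open>Position \<open>k\<close> is a block of its own when \<open>k - 1\<close> and
  \<open>k\<close> are both stable. So the condition says that no position lies in nontrivial blocks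
  of both generators.\<close>

definition apart :: "'a \<Rightarrow> 'a \<Rightarrow> bool" where
  "apart r s \<longleftrightarrow> (\<forall>k\<in>{1..n}. stab r (k - 1) \<and> stab r k \<or> stab s (k - 1) \<and> stab s k)"

lemma apart_sym: "apart r s \<Longrightarrow> apart s r"
  by (auto simp: apart_def)

text \<open>If \<open>k - 1\<close> or \<open>k\<close> is unstable under \<open>s\<close>, it is
  interior to a nontrivial block which, with its ends, contains both.\<close>

lemma apartI:
  assumes s: "s \<in> S"
    and block: "\<And>i j k. Suc i < j \<Longrightarrow> j \<le> n \<Longrightarrow> stab s i \<Longrightarrow> stab s j \<Longrightarrow>
      (\<And>l. i < l \<Longrightarrow> l < j \<Longrightarrow> \<not> stab s l) \<Longrightarrow> i \<le> k \<Longrightarrow> k \<le> j \<Longrightarrow> stab r k"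
  shows "apart r s"
  unfolding apart_def
proof (intro ballI)
  fix k assume k: "k \<in> {1..n}"
  have around: "stab r m" if l: "l \<le> n" "\<not> stab s l" and m: "m = l - 1 \<or> m = l \<or> m = Suc l" for l m
  proof -
    obtain i j where ij: "i < l" "l < j" "j \<le> n" "stab s i" "stab s j"
      "\<And>l. i < l \<Longrightarrow> l < j \<Longrightarrow> \<not> stab s l"
      using block_around[OF s l] by blast
    then show ?thesis using m by (intro block[of i j]) auto
  qed
  show "stab r (k - 1) \<and> stab r k \<or> stab s (k - 1) \<and> stab s k"
    using around[of k "k-1"] around[of k k] around[of "k-1" "k-1"] around[of "k-1" k] k by auto
qed

lemma apart_stab_block:
  assumes "apart r s" "Suc i < j" "j \<le> n" "\<And>l. i < l \<Longrightarrow> l < j \<Longrightarrow> \<not> stab s l" "i \<le> k" "k \<le> j"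
  shows "stab r k"
proof (cases "k = j")
  case True
  then show ?thesis using assms(1)[unfolded apart_def, rule_format, of k] assms(2,3) assms(4)[of "j-1"] by auto
next
  case False
  then have "Suc k \<in> {1..n}" using assms by auto
  note a1 = assms(1)[unfolded apart_def, rule_format, OF this]
  show ?thesis
  proof (cases "k = i")
    case True
    then show ?thesis using a1 assms(2) assms(4)[of "Suc k"] by auto
  next
    case kne: False
    then show ?thesis using a1 assms(4)[of k] assms False by auto
  qed
qed

lemma apart_fixes:
  assumes "apart r s" "r \<in> S" "s \<in> S" "k \<in> {1..n}"
  shows "\<phi> r k = k \<or> \<phi> s k = k"
  using assms(1)[unfolded apart_def, rule_format, OF assms(4)] assms(4)
    stab_fixes[OF assms(2), of k] stab_fixes[OF assms(3), of k] by auto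

text \<open>At most one of the two permutations moves a given point, and it takes it to a point
  fixed by the other. Injectivity of \<open>\<phi>\<close> carries this back to the group.\<close>

lemma apart_commute:
  assumes ap: "apart r s" and rs: "r \<in> S" "s \<in> S"
  shows "r \<otimes> s = s \<otimes> r"
proof (rule phi_inj)
  have *: "\<phi> s (\<phi> r k) = \<phi> r (\<phi> s k)" if "\<phi> s k = k" "apart r s" "r \<in> S" "s \<in> S" "k \<in> {1..n}" for r s k
  proof (cases "\<phi> r k = k")
    case False
    have "\<phi> r k \<in> {1..n}" using that permutes_in_image[OF phi_permutes[OF S_carrier]] by blast
    then have "\<phi> r (\<phi> r k) = \<phi> r k \<or> \<phi> s (\<phi> r k) = \<phi> r k" using apart_fixes that by blast
    then show ?thesis using that False by auto
  qed (use that in simp)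
  have "\<phi> s (\<phi> r k) = \<phi> r (\<phi> s k)" for k
  proof (cases "k \<in> {1..n}")
    case True
    then show ?thesis using *[of s k r] *[of r k s] apart_fixes[OF ap rs True] ap apart_sym rs by metis
  next
    case False
    then show ?thesis using permutes_not_in[OF phi_permutes[OF S_carrier]] rs by metis
  qed
  then show "\<phi> (r \<otimes> s) = \<phi> (s \<otimes> r)" using rs S_carrier by (simp add: phi_mult fun_eq_iff)
qed (use rs S_carrier in auto)

lemma cox_m_apart:
  assumes ap: "apart r s" and rs: "r \<in> S" "s \<in> S" "r \<noteq> s"
  shows "cox_m G r s = 2"
proof -
  have c: "r \<in> carrier G" "s \<in> carrier G" using rs S_carrier by auto
  have "(r \<otimes> s) [^] (2::nat) = (r \<otimes> s) \<otimes> (s \<otimes> r)"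
    using apart_commute[OF ap rs(1,2)] c by (simp add: numeral_2_eq_2)
  also have "\<dots> = r \<otimes> ((s \<otimes> s) \<otimes> r)" using c by (simp add: m_assoc)
  also have "\<dots> = \<one>" using rs S_square c by simp
  finally have dvd: "ord (r \<otimes> s) dvd 2" using pow_eq_id[of "r \<otimes> s" 2] c by simp
  have "r \<otimes> s \<noteq> s \<otimes> s" using rs c by simp
  then have "ord (r \<otimes> s) \<noteq> 1" using ord_eq_1[of "r \<otimes> s"] c S_square rs by simp
  then show ?thesis unfolding cox_m_def using dvd_imp_le[OF dvd] dvd
    by (cases "ord (r \<otimes> s) = 0") auto
qed

section \<open>The curves of a tiling over a given height\<close>

lemma mem_tiling_iff:
  assumes "set ws \<subseteq> S"
  shows "(c, y) \<in> tiling G n \<phi> ws \<longleftrightarrow>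
    y \<in> {0..border_height n} \<and> (\<exists>m\<le>length ws. c = bx (ev (take m ws)) y)"
proof -
  have "\<phi> (ev (take m ws)) permutes {1..n}" for m
    using assms set_take_subset[of m ws] by (intro phi_permutes ev_closed) auto
  then show ?thesis
    by (auto simp: tiling_def border_phi_def mem_border_iff_border_x[OF n2])
qed

lemma bx_mono:
  assumes "reduced_word G S (us @ vs)" "y \<in> {0..border_height n}"
  shows "bx (ev us) y \<le> bx (ev (us @ vs)) y"
  using reduced_wordD(1)[OF assms(1)]
  by (intro border_x_mono[OF n2 _ _ reduced_border_le[OF assms(1)] assms(2)] phi_permutes ev_closed) auto

lemma bx_take_mono:
  assumes "reduced_word G S ws" "l \<le> m" "y \<in> {0..border_height n}"
  shows "bx (ev (take l ws)) y \<le> bx (ev (take m ws)) y"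
proof -
  have e: "take m ws = take l ws @ drop l (take m ws)"
    using append_take_drop_id[of l "take m ws"] assms(2) by (simp add: min_def)
  have "reduced_word G S (take m ws @ drop m ws)" using assms(1) by simp
  then have "reduced_word G S (take m ws)" by (rule reduced_prefix)
  then show ?thesis using bx_mono[OF _ assms(3)] e by metis
qed

text \<open>Abscissas at height \<open>y\<close> increase weakly along a reduced word, so no curve
  runs strictly between the borders before and after a letter.\<close>

lemma tiling_gap:
  assumes red: "reduced_word G S (us @ s # vs)" and c: "(c, y) \<in> tiling G n \<phi> (us @ s # vs)"
  shows "c \<le> bx (ev us) y \<or> bx (ev (us @ [s])) y \<le> c"
proof -
  let ?ws = "us @ s # vs"
  obtain m where y: "y \<in> {0..border_height n}" and c: "c = bx (ev (take m ?ws)) y"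
    using c mem_tiling_iff[OF reduced_wordD(1)[OF red]] by blast
  show ?thesis
  proof (cases "m \<le> length us")
    case True
    then show ?thesis using bx_take_mono[OF red True y] c by simp
  next
    case False
    then show ?thesis using bx_take_mono[OF red _ y, of "Suc (length us)" m] c by simp
  qed
qed

lemma bx_mem_tiling:
  assumes "set (us @ vs) \<subseteq> S" "y \<in> {0..border_height n}"
  shows "(bx (ev us) y, y) \<in> tiling G n \<phi> (us @ vs)"
  unfolding mem_tiling_iff[OF assms(1)] using assms(2)
  by (auto intro!: exI[of _ "length us"])

text \<open>If the images agree, \<open>r \<otimes> s\<close> fixes \<open>Suc i\<close>, and vertex
  \<open>Suc i\<close> is the same for \<open>\<one>\<close> and \<open>r \<otimes> s\<close>. The
  border of \<open>r\<close> lies between theirs, so \<open>r\<close> keeps that vertex and fixes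
  \<open>Suc i\<close>; then so does \<open>s\<close>, which makes \<open>Suc i\<close>
  stable.\<close>

lemma no_common_block:
  assumes rs: "r \<in> S" "s \<in> S" "r \<noteq> s" and st: "stab r i" "\<not> stab s (Suc i)" "stab s i" and k: "Suc i \<le> n"
    and eq: "\<phi> r (Suc i) = \<phi> s (Suc i)"
  shows False
proof -
  have rc: "r \<in> carrier G" "s \<in> carrier G" using rs S_carrier by auto
  have red: "reduced_word G S ([r] @ [s])" using reduced_pair[OF rs] by simp
  have 2: "border_le n (\<phi> r) (\<phi> (r \<otimes> s))" using reduced_border_le_snoc[OF red] rc by simp
  have 1: "border_le n (\<phi> \<one>) (\<phi> (\<one> \<otimes> r))"
    using reduced_border_le_snoc[of "[]" r] reduced_letter[OF rs(1)] rc by simp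
  let ?p = "\<phi> (r \<otimes> s)"
  have p: "?p permutes {1..n}" using phi_permutes rc by simp
  have pe: "?p = \<phi> s \<circ> \<phi> r" using rc by (simp add: phi_mult)
  have "?p ` {1..i} = {1..i}" using st unfolding pe stab_def by (metis image_comp)
  moreover have "?p (Suc i) = Suc i" using eq rs by (simp add: pe)
  ultimately have im: "?p ` {1..Suc i} = {1..Suc i}" by (simp add: atLeastAtMostSuc_conv)
  have "Hilbert_Choice.inv ?p ` {1..Suc i} = Hilbert_Choice.inv ?p ` (?p ` {1..Suc i})" by (simp only: im)
  also have "\<dots> = {1..Suc i}" using permutes_inj[OF p] by (simp add: image_inv_f_f)
  finally have "pt (r \<otimes> s) (Suc i) = pt \<one> (Suc i)"
    by (intro border_pt_cong_image[OF phi_permutes p]) (auto simp: phi_one)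
  then have "pt (\<one> \<otimes> r) (Suc i) = pt \<one> (Suc i)"
    using border_le_antisym_pt[OF 1 _ k] 2 rc by simp
  then have "stab r (Suc i)" using stab_if_pt_eq[OF _ rs(1) k 1] by simp
  then have "\<phi> r (Suc i) = Suc i" using stab_fixes[OF rs(1), of "Suc i"] st by simp
  then show False using stab_Suc[OF st(3)] st(2) eq by simp
qed

text \<open>By \<open>alt\<close>, the open interval of heights of the block is covered by the two disjoint relatively closed
  sets where the border of \<open>z \<otimes> r\<close> agrees with that of \<open>z\<close> and with that of \<open>x \<otimes> s\<close>; by connectedness one
  of them is everything.\<close>

lemma block_stab:
  assumes x: "x \<in> carrier G" and z: "z \<in> carrier G" and rs: "r \<in> S" "s \<in> S" "r \<noteq> s"
    and le_s: "border_le n (\<phi> x) (\<phi> (x \<otimes> s))" and le_r: "border_le n (\<phi> z) (\<phi> (z \<otimes> r))"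
    and ij: "Suc i < j" "j \<le> n" and st: "stab s i" "stab s j"
    and nst: "\<And>l. i < l \<Longrightarrow> l < j \<Longrightarrow> \<not> stab s l"
    and pt_eq: "\<And>l. i \<le> l \<Longrightarrow> l \<le> j \<Longrightarrow> pt z l = pt x l"
    and alt: "\<And>y. y \<in> {0..border_height n} \<Longrightarrow> bx z y = bx x y \<Longrightarrow> bx x y < bx (x \<otimes> s) y \<Longrightarrow>
      bx (z \<otimes> r) y = bx z y \<or> bx (z \<otimes> r) y = bx (x \<otimes> s) y"
    and l: "i \<le> l" "l \<le> j"
  shows "stab r l"
proof -
  have rc: "r \<in> carrier G" "s \<in> carrier G" using rs S_carrier by auto
  have perm: "\<phi> x permutes {1..n}" "\<phi> z permutes {1..n}" "\<phi> (x \<otimes> s) permutes {1..n}" "\<phi> (z \<otimes> r) permutes {1..n}"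
    using x z rc phi_permutes[of x] phi_permutes[of z] phi_permutes[of "x \<otimes> s"] phi_permutes[of "z \<otimes> r"] by simp_all
  define a b where "a = snd (pt x i)" and "b = snd (pt x j)"
  have xs: "pt (x \<otimes> s) i = pt x i" "pt (x \<otimes> s) j = pt x j"
    using pt_mult_stab x rs st by auto
  have ab: "a < b" unfolding a_def b_def
    using border_pt_diff_timelike(2)[OF n2 perm(1), of i j] ij by simp
  have rng: "{a..b} \<subseteq> {0..border_height n}"
    using border_pt_height[OF n2 perm(1), of i] border_pt_height[OF n2 perm(1), of j] ij
    by (auto simp: a_def b_def)
  have zx: "bx z y = bx x y" if "y \<in> {a..b}" for y
    using that ij pt_eq by (intro border_x_cong_block[OF n2 perm(2,1), of i j]) (auto simp: a_def b_def)
  have less: "bx x y < bx (x \<otimes> s) y" if "y \<in> {a<..<b}" for y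
  proof (rule border_x_less_in_block[OF n2 perm(1,3) le_s ij])
    show "pt (x \<otimes> s) k \<noteq> pt x k" if "i < k" "k < j" for k
      using stab_if_pt_eq[OF x rs(2) _ le_s] nst[OF that] that ij by force
  qed (use that xs in \<open>auto simp: a_def b_def\<close>)
  define A where "A = {y \<in> {0..border_height n}. bx (z \<otimes> r) y - bx z y = 0}"
  define B where "B = {y \<in> {0..border_height n}. bx (z \<otimes> r) y - bx (x \<otimes> s) y = 0}"
  have cl: "closed A" "closed B" unfolding A_def B_def
    by (intro continuous_closed_preimage_constant continuous_on_diff continuous_on_border_x[OF n2] perm closed_atLeastAtMost)+
  have cover: "{a<..<b} \<subseteq> A \<union> B"
  proof
    fix y assume y: "y \<in> {a<..<b}"
    then have "y \<in> {0..border_height n}" "bx z y = bx x y" using rng zx by auto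
    with alt[OF this less[OF y]] show "y \<in> A \<union> B" by (auto simp: A_def B_def)
  qed
  have "\<not> (y \<in> A \<and> y \<in> B)" if "y \<in> {a<..<b}" for y
    using less[OF that] zx[of y] that by (auto simp: A_def B_def)
  then have "A \<inter> B \<inter> {a<..<b} = {}" by blast
  then have "A \<inter> {a<..<b} = {} \<or> B \<inter> {a<..<b} = {}"
    using connected_closedD[of "{a<..<b}" A B] cl cover connected_Ioo by blast
  then have "{a<..<b} \<subseteq> A \<or> {a<..<b} \<subseteq> B" using cover by blast
  \<comment> \<open>Closures are taken because the vertices at the end heights \<open>a\<close> and
    \<open>b\<close> are compared as well.\<close>
  then have "{a..b} \<subseteq> A \<or> {a..b} \<subseteq> B"
    using closure_minimal cl closure_greaterThanLessThan[OF ab] by metis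
  then show ?thesis
  proof
    \<comment> \<open>Here the vertices of \<open>z\<close> over the block lie on the border of
      \<open>z \<otimes> r\<close>, so \<open>r\<close> does not move them.\<close>
    assume A: "{a..b} \<subseteq> A"
    have "a \<le> snd (pt x l)" "snd (pt x l) \<le> b"
      using border_pt_diff_timelike(1)[OF n2 perm(1), of i l] border_pt_diff_timelike(1)[OF n2 perm(1), of l j] l ij
      by (auto simp: a_def b_def)
    then have "bx (z \<otimes> r) (snd (pt z l)) = bx z (snd (pt z l))"
      using A pt_eq[OF l] by (auto simp: A_def)
    moreover have "pt z l \<in> border (pi/4) n (\<phi> z)" using n2 l ij by (intro border_pt_mem_border) auto
    ultimately have "pt z l \<in> border (pi/4) n (\<phi> (z \<otimes> r))"
      using mem_border_iff_border_x[OF n2 perm(2), of "fst (pt z l)" "snd (pt z l)"]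
        mem_border_iff_border_x[OF n2 perm(4), of "fst (pt z l)" "snd (pt z l)"] by (metis prod.collapse)
    then have "pt (z \<otimes> r) l = pt z l" using border_pt_eq_if_common[OF n2 perm(4) le_r] l ij by simp
    then show ?thesis using stab_if_pt_eq[OF z rs(1) _ le_r] l ij by simp
  next
    \<comment> \<open>Here the first edges of \<open>z \<otimes> r\<close> and
      \<open>x \<otimes> s\<close> in the block have the same label. As \<open>z\<close> and
      \<open>x\<close> have equal labels throughout the block, \<open>r\<close> and \<open>s\<close>
      send \<open>Suc i\<close> to the same position, which \<open>no_common_block\<close>
      excludes.\<close>
    assume B: "{a..b} \<subseteq> B"
    then have eqB: "bx (z \<otimes> r) y = bx (x \<otimes> s) y" if "y \<in> {a..b}" for y using that by (auto simp: B_def)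
    have "bx (z \<otimes> r) (snd (pt (x \<otimes> s) i)) = bx (x \<otimes> s) (snd (pt (x \<otimes> s) i))"
      using eqB[of a] ab xs by (simp add: a_def)
    moreover have "pt (x \<otimes> s) i \<in> border (pi/4) n (\<phi> (x \<otimes> s))" using n2 ij by (intro border_pt_mem_border) auto
    ultimately have "pt (x \<otimes> s) i \<in> border (pi/4) n (\<phi> (z \<otimes> r))"
      using mem_border_iff_border_x[OF n2 perm(3), of "fst (pt (x \<otimes> s) i)" "snd (pt (x \<otimes> s) i)"]
        mem_border_iff_border_x[OF n2 perm(4), of "fst (pt (x \<otimes> s) i)" "snd (pt (x \<otimes> s) i)"]
      by (metis prod.collapse)
    then have "pt z i \<in> border (pi/4) n (\<phi> (z \<otimes> r))" using xs pt_eq[of i] ij by simp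
    then have pti: "pt (z \<otimes> r) i = pt z i" using border_pt_eq_if_common[OF n2 perm(4) le_r] ij by simp
    then have sti: "stab r i" using stab_if_pt_eq[OF z rs(1) _ le_r] ij by simp
    have lab: "Hilbert_Choice.inv (\<phi> z) m = Hilbert_Choice.inv (\<phi> x) m" if "i < m" "m \<le> j" for m
      using that ij pt_eq zx
      by (intro inv_eq_on_block[OF n2 perm(2,1), of j i]) (auto simp: a_def b_def)
    have "Hilbert_Choice.inv (\<phi> (z \<otimes> r)) (Suc i) = Hilbert_Choice.inv (\<phi> (x \<otimes> s)) (Suc i)"
      using ij pti xs pt_eq[of i] eqB
      by (intro inv_eq_on_block[OF n2 perm(4,3), of j i]) (auto simp: a_def b_def)
    then have "Hilbert_Choice.inv (\<phi> z) (\<phi> r (Suc i)) = Hilbert_Choice.inv (\<phi> x) (\<phi> s (Suc i))"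
      using x z rs by (simp add: inv_phi_mult)
    also have "\<dots> = Hilbert_Choice.inv (\<phi> z) (\<phi> s (Suc i))"
      using stab_block_mem[OF rs(2) st, of "Suc i"] ij lab by simp
    finally have "\<phi> r (Suc i) = \<phi> s (Suc i)"
      using permutes_inj[OF permutes_inv[OF perm(2)]] by (auto dest: injD)
    then show ?thesis using no_common_block[OF rs sti _ st(1)] nst[of "Suc i"] ij by simp
  qed
qed

lemma pt_apart_word:
  assumes "x \<in> carrier G" "set us \<subseteq> S" "\<forall>q\<in>set us. stab q k"
  shows "pt (x \<otimes> ev us) k = pt x k"
  using assms
proof (induction us arbitrary: x)
  case (Cons q us)
  then have "pt (x \<otimes> q \<otimes> ev us) k = pt x k" using S_carrier by (simp add: pt_mult_stab)
  then show ?case using Cons.prems S_carrier by (simp add: m_assoc)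
qed simp

text \<open>The letters of \<open>u\<close> keep all vertices over a nontrivial block of
  \<open>s\<close>, so the borders of \<open>x\<close> and \<open>x @ u\<close> agree there and
  \<open>block_stab\<close> can compare the next letters \<open>s\<close> and
  \<open>r\<close>.\<close>

lemma same_tiling_apart:
  assumes red: "reduced_word G S (x @ s # a)" "reduced_word G S (x @ u @ r # b)"
    and til: "tiling G n \<phi> (x @ s # a) = tiling G n \<phi> (x @ u @ r # b)"
    and ap: "\<forall>q\<in>set u. apart q s" and ne: "r \<noteq> s"
  shows "apart r s"
proof (rule apartI)
  have S: "set x \<subseteq> S" "s \<in> S" "set a \<subseteq> S" "set u \<subseteq> S" "r \<in> S" "set b \<subseteq> S"
    using reduced_wordD(1)[OF red(1)] reduced_wordD(1)[OF red(2)] by auto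
  show "s \<in> S" by fact
  fix i j k assume blk: "Suc i < j" "j \<le> n" "stab s i" "stab s j" "i \<le> k" "k \<le> j"
    and nst: "\<And>l. i < l \<Longrightarrow> l < j \<Longrightarrow> \<not> stab s l"
  let ?x = "ev x" and ?z = "ev x \<otimes> ev u"
  have cl: "?x \<in> carrier G" "?z \<in> carrier G" using S by auto
  have e: "ev (x @ u) = ?z" "ev (x @ [s]) = ?x \<otimes> s" "ev ((x @ u) @ [r]) = ?z \<otimes> r"
    using S by (simp_all only: ev_append ev_snoc set_append Un_subset_iff)
  have le_s: "border_le n (\<phi> ?x) (\<phi> (?x \<otimes> s))"
    using reduced_border_le_snoc[of x s] reduced_prefix[of "x @ [s]" a] red(1) e by simp
  have le_r: "border_le n (\<phi> ?z) (\<phi> (?z \<otimes> r))"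
    using reduced_border_le_snoc[of "x @ u" r] reduced_prefix[of "x @ u @ [r]" b] red(2) e by simp
  show "stab r k"
  proof (rule block_stab[OF cl S(5,2) ne le_s le_r blk(1-4) nst _ _ blk(5,6)])
    show "pt ?z l = pt ?x l" if "i \<le> l" "l \<le> j" for l
      using that S ap blk nst apart_stab_block by (intro pt_apart_word) (auto)
    fix y assume y: "y \<in> {0..border_height n}" and zx: "bx ?z y = bx ?x y" and less: "bx ?x y < bx (?x \<otimes> s) y"
    \<comment> \<open>The common tiling has a gap to the right of \<open>?x\<close> and one to the
      right of \<open>?z\<close>. Testing the right border of each gap against the other gap yields
      the alternative that \<open>block_stab\<close> asks for.\<close>
    have gap1: "c \<le> bx ?x y \<or> bx (?x \<otimes> s) y \<le> c" if "(c, y) \<in> tiling G n \<phi> (x @ s # a)" for c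
      using tiling_gap[OF red(1) that] e by simp
    have gap2: "c \<le> bx ?z y \<or> bx (?z \<otimes> r) y \<le> c" if "(c, y) \<in> tiling G n \<phi> (x @ s # a)" for c
      using tiling_gap[of "x @ u" r b c y] red(2) til e that by simp
    have m1: "(bx (?x \<otimes> s) y, y) \<in> tiling G n \<phi> (x @ s # a)"
      using bx_mem_tiling[of "x @ [s]" a y] e S y by simp
    have m2: "(bx (?z \<otimes> r) y, y) \<in> tiling G n \<phi> (x @ s # a)"
      using bx_mem_tiling[of "x @ u @ [r]" b y] e S y til by simp
    have "bx ?z y \<le> bx (?z \<otimes> r) y"
      using border_x_mono[OF n2 _ _ le_r y] phi_permutes cl S S_carrier by simp
    then show "bx (?z \<otimes> r) y = bx ?z y \<or> bx (?z \<otimes> r) y = bx (?x \<otimes> s) y"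
      using gap1[OF m2] gap2[OF m1] zx less by linarith
  qed
qed

lemma ex_not_stab:
  assumes "s \<in> S"
  shows "\<exists>k\<le>n. \<not> stab s k"
proof (rule ccontr)
  assume "\<not> ?thesis"
  then have st: "stab s k" if "k \<le> n" for k using that by blast
  have "\<phi> s k = k" for k
  proof (cases "k \<in> {1..n}")
    case True
    then show ?thesis using st by (intro stab_fixes assms) auto
  next
    case False
    then show ?thesis using permutes_not_in[OF phi_permutes[OF S_carrier[OF assms]]] by blast
  qed
  then have "\<phi> s = \<phi> \<one>" by (simp add: fun_eq_iff phi_one)
  then show False using phi_inj S_carrier S_ne_one assms by blast
qed

text \<open>The letters before the first \<open>s\<close> are apart from \<open>s\<close> one after
  the other. If \<open>s\<close> did not occur in \<open>b\<close>, a vertex inside a block of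
  \<open>s\<close> would be the same for \<open>x\<close> and for the whole word, hence also for
  \<open>x @ [s]\<close>, although \<open>s\<close> moves it.\<close>

lemma same_tiling_first_letter:
  assumes red: "reduced_word G S (x @ s # a)" "reduced_word G S (x @ b)"
    and til: "tiling G n \<phi> (x @ s # a) = tiling G n \<phi> (x @ b)" and ev: "ev (x @ s # a) = ev (x @ b)"
  obtains u v where "b = u @ s # v" "\<forall>q\<in>set u. q \<noteq> s \<and> apart q s"
proof -
  have S: "set x \<subseteq> S" "s \<in> S" "set a \<subseteq> S" "set b \<subseteq> S"
    using reduced_wordD(1)[OF red(1)] reduced_wordD(1)[OF red(2)] by auto
  have ap: "\<forall>q\<in>set u. apart q s" if "b = u @ v" "s \<notin> set u" for u v
    using that
  proof (induction u arbitrary: v rule: rev_induct)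
    case (snoc r u)
    then have IH: "\<forall>q\<in>set u. apart q s" by auto
    have "apart r s"
      using same_tiling_apart[OF red(1), of u r v] red(2) til IH snoc.prems by auto
    then show ?case using IH by auto
  qed simp
  show thesis
  proof (cases "s \<in> set b")
    case True
    then obtain u v where "b = u @ s # v" "s \<notin> set u" by (meson split_list_first)
    then show thesis using that[of u v] ap[of u "s # v"] by auto
  next
    case False
    obtain k where k: "k \<le> n" "\<not> stab s k" using ex_not_stab[OF S(2)] by blast
    obtain i j where ij: "i < k" "k < j" "j \<le> n" "\<And>l. i < l \<Longrightarrow> l < j \<Longrightarrow> \<not> stab s l"
      using block_around[OF S(2) k] by blast
    have "\<forall>q\<in>set b. stab q k"
      using apart_stab_block[of _ s i j k] ij ap[of b "[]"] False by force
    then have "pt (ev x \<otimes> ev b) k = pt (ev x) k" using S by (intro pt_apart_word) auto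
    then have eq: "pt (ev (x @ s # a)) k = pt (ev x) k" using ev S by (simp add: ev_append)
    have 1: "border_le n (\<phi> (ev x)) (\<phi> (ev x \<otimes> s))"
      using reduced_border_le_snoc[of x s] reduced_prefix[of "x @ [s]" a] red(1) ev_snoc S by simp
    have 2: "border_le n (\<phi> (ev x \<otimes> s)) (\<phi> (ev (x @ s # a)))"
      using reduced_border_le[of "x @ [s]" a] red(1) ev_snoc S by simp
    have "pt (ev x \<otimes> s) k = pt (ev x) k" by (rule border_le_antisym_pt[OF 1 2 k(1) eq])
    then show thesis using stab_if_pt_eq[OF _ S(2) k(1) 1] k(2) S by simp
  qed
qed

section \<open>From apart generators to pairs in \<open>J_phi\<close>\<close>

lemma border_apart_subset:
  assumes u: "u \<in> carrier G" and rs: "r \<in> S" "s \<in> S" and ap: "apart r s"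
  shows "border_phi n \<phi> (u \<otimes> s) \<subseteq> border_phi n \<phi> u \<union> border_phi n \<phi> (u \<otimes> s \<otimes> r)"
proof
  fix q assume "q \<in> border_phi n \<phi> (u \<otimes> s)"
  then obtain k t where k: "k \<in> {1..n}" "0 \<le> t" "t \<le> 1" "q = edge_pt n (\<phi> (u \<otimes> s)) k t"
    unfolding border_phi_def mem_border_iff by blast
  have c: "u \<otimes> s \<in> carrier G" using u rs S_carrier by simp
  consider "stab r (k - 1)" "stab r k" | "stab s (k - 1)" "stab s k"
    using ap k(1) unfolding apart_def by blast
  then have "q = edge_pt n (\<phi> u) k t \<or> q = edge_pt n (\<phi> (u \<otimes> s \<otimes> r)) k t"
    by cases (auto simp: k(4) edge_pt_def pt_mult_stab u c rs)
  then show "q \<in> border_phi n \<phi> u \<union> border_phi n \<phi> (u \<otimes> s \<otimes> r)"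
    using k unfolding border_phi_def Un_iff mem_border_iff by blast
qed

text \<open>The two words have the same prefix values except one letter after \<open>x\<close>. The
  border arising there is covered, edge by edge, by its two neighbours, which both words
  share.\<close>

lemma tiling_apart_subset:
  assumes S: "set x \<subseteq> S" "set y \<subseteq> S" and rs: "r \<in> S" "s \<in> S" and ap: "apart r s"
  shows "tiling G n \<phi> (x @ [s, r] @ y) \<subseteq> tiling G n \<phi> (x @ [r, s] @ y)"
proof -
  have mem: "border_phi n \<phi> (ev p) \<subseteq> tiling G n \<phi> (p @ q)" for p q
    unfolding tiling_def by (auto intro!: bexI[of _ "length p"])
  have comm: "r \<otimes> (s \<otimes> g) = s \<otimes> (r \<otimes> g)" if "g \<in> carrier G" for g
    using apart_commute[OF ap rs] that rs S_carrier by (metis m_assoc)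
  have "border_phi n \<phi> (ev (take m (x @ [s, r] @ y))) \<subseteq> tiling G n \<phi> (x @ [r, s] @ y)" for m
  proof -
    consider "m \<le> length x" | "m = Suc (length x)" | d where "m = length x + 2 + d"
      by (metis add_2_eq_Suc' add_Suc_right le_add_diff_inverse not_less_eq_eq le_antisym)
    then show ?thesis
    proof cases
      case 1
      then have "take m (x @ [s, r] @ y) = take m x" by simp
      moreover have "take m x @ drop m x @ [r, s] @ y = x @ [r, s] @ y" by (metis append_assoc append_take_drop_id)
      ultimately show ?thesis using mem[of "take m x" "drop m x @ [r, s] @ y"] by metis
    next
      case 2
      have "border_phi n \<phi> (ev x \<otimes> s) \<subseteq> border_phi n \<phi> (ev x) \<union> border_phi n \<phi> (ev x \<otimes> s \<otimes> r)"
        using border_apart_subset ap rs S by simp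
      moreover have "ev x \<otimes> s \<otimes> r = ev (x @ [r, s])"
        using S rs S_carrier apart_commute[OF ap rs] by (simp add: ev_append m_assoc)
      ultimately show ?thesis using 2 mem[of x "[r, s] @ y"] mem[of "x @ [r, s]" y] ev_snoc S rs by auto
    next
      case 3
      have "set (take d y) \<subseteq> S" using S set_take_subset by fastforce
      then have "ev (x @ [s, r] @ take d y) = ev (x @ [r, s] @ take d y)"
        using S rs S_carrier by (simp add: ev_append comm)
      then show ?thesis using 3 mem[of "x @ [r, s] @ take d y" "drop d y"] by (simp add: numeral_2_eq_2)
    qed
  qed
  then show ?thesis unfolding tiling_def[of G n \<phi> "x @ [s, r] @ y"] by blast
qed

lemma alt_word_2: "alt_word s r 2 = [s, r]"
  by (simp add: alt_word_def numeral_2_eq_2)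

lemma apart_J_phi:
  assumes rs: "r \<in> S" "s \<in> S" "r \<noteq> s" and ap: "apart r s"
  shows "{r, s} \<in> J_phi G S n \<phi>"
proof -
  have "J_cond G S n \<phi> s r"
    unfolding J_cond_def cox_m_apart[OF apart_sym[OF ap] rs(2,1) rs(3)[symmetric]] alt_word_2
  proof (intro allI impI)
    fix x y assume "reduced_word G S (x @ [s, r] @ y)"
    from reduced_wordD(1)[OF this] have "set x \<subseteq> S" "set y \<subseteq> S" by auto
    then show "tiling G n \<phi> (x @ [s, r] @ y) = tiling G n \<phi> (x @ [r, s] @ y)"
      using tiling_apart_subset[OF _ _ rs(1,2) ap] tiling_apart_subset[OF _ _ rs(2,1) apart_sym[OF ap]]
      by blast
  qed
  then show ?thesis using rs by (auto simp: J_phi_def)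
qed

section \<open>Braid moves in \<open>J_phi\<close>: what they connect and what they preserve\<close>

abbreviation J_equiv :: "'a list \<Rightarrow> 'a list \<Rightarrow> bool" where
  "J_equiv \<equiv> equivclp (J_braid_step G (J_phi G S n \<phi>))"

lemma J_step_apart:
  assumes rs: "r \<in> S" "s \<in> S" "r \<noteq> s" and ap: "apart r s"
  shows "J_braid_step G (J_phi G S n \<phi>) (x @ [s, r] @ y) (x @ [r, s] @ y)"
  unfolding J_braid_step_def
  using apart_J_phi[OF assms] rs cox_m_apart[OF apart_sym[OF ap] rs(2,1) rs(3)[symmetric]]
  by (intro exI[of _ x] exI[of _ y] exI[of _ r] exI[of _ s]) (metis alt_word_2)

lemma J_equiv_move_front:
  assumes "set u \<subseteq> S" "s \<in> S" "\<forall>q\<in>set u. q \<noteq> s \<and> apart q s"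
  shows "J_equiv (x @ u @ s # v) (x @ s # u @ v)"
  using assms
proof (induction u arbitrary: x)
  case (Cons q u)
  have "J_equiv ((x @ [q]) @ u @ s # v) ((x @ [q]) @ s # u @ v)" using Cons by (intro Cons.IH) auto
  moreover have "J_braid_step G (J_phi G S n \<phi>) (x @ [s, q] @ u @ v) (x @ [q, s] @ u @ v)"
    using Cons.prems by (intro J_step_apart) auto
  ultimately have "J_equiv (x @ q # u @ s # v) (x @ q # s # u @ v)"
    "J_equiv (x @ q # s # u @ v) (x @ s # q # u @ v)" by auto
  then show ?case using equivclp_trans by fastforce
qed simp

text \<open>At \<open>k = ord (s \<otimes> r)\<close> the power disappears, which gives the braid
  relation.\<close>

lemma ev_alt_word:
  assumes "r \<in> carrier G" "s \<in> carrier G"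
    and "r \<otimes> r = \<one>" "s \<otimes> s = \<one>"
  shows "ev (alt_word s r k) = (s \<otimes> r) [^] k \<otimes> ev (alt_word r s k)"
proof -
  have alt_Suc: "alt_word s r (Suc k) = s # alt_word r s k" for s r :: 'a and k
    by (simp add: alt_word_def map_upt_Suc del: upt_Suc)
  have cl: "ev (alt_word s r k) \<in> carrier G" if "r \<in> carrier G" "s \<in> carrier G" for s r k
    using that by (induction k arbitrary: r s) (auto simp: alt_Suc, simp add: alt_word_def)
  have "ev (alt_word s r k) = (s \<otimes> r) [^] k \<otimes> ev (alt_word r s k)"
    if "r \<in> carrier G" "s \<in> carrier G" "r \<otimes> r = \<one>" "s \<otimes> s = \<one>" for s r
    using that
  proof (induction k arbitrary: r s)
    case 0
    then show ?case by (simp add: alt_word_def)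
  next
    case (Suc k)
    let ?e = "ev (alt_word s r k)"
    have c: "?e \<in> carrier G" "(r \<otimes> s) [^] k \<in> carrier G" "(s \<otimes> r) [^] k \<in> carrier G"
      using cl Suc.prems by auto
    have shift: "s \<otimes> (r \<otimes> s) [^] m = (s \<otimes> r) [^] m \<otimes> s" for m :: nat
    proof (induction m)
      case (Suc m)
      have "s \<otimes> (r \<otimes> s) [^] Suc m = (s \<otimes> (r \<otimes> s) [^] m) \<otimes> (r \<otimes> s)"
        using \<open>r \<in> carrier G\<close> \<open>s \<in> carrier G\<close> by (simp add: m_assoc)
      then show ?case using Suc \<open>r \<in> carrier G\<close> \<open>s \<in> carrier G\<close> by (simp add: m_assoc)
    qed (use \<open>s \<in> carrier G\<close> in simp)
    have "ev (alt_word s r (Suc k)) = s \<otimes> ((r \<otimes> s) [^] k \<otimes> ?e)"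
      using Suc.IH[of s r] Suc.prems by (simp add: alt_Suc)
    also have "\<dots> = (s \<otimes> (r \<otimes> s) [^] k) \<otimes> ?e" using c Suc.prems by (simp add: m_assoc)
    \<comment> \<open>One inserted \<open>r\<close> completes the new factor
      \<open>s \<otimes> r\<close> of the power, the other becomes the first letter of the longer
      word.\<close>
    also have "?e = r \<otimes> (r \<otimes> ?e)" using c Suc.prems by (simp flip: m_assoc)
    also have "(s \<otimes> (r \<otimes> s) [^] k) \<otimes> (r \<otimes> (r \<otimes> ?e)) = ((s \<otimes> r) [^] k \<otimes> s) \<otimes> (r \<otimes> (r \<otimes> ?e))"
      using shift by simp
    also have "\<dots> = (s \<otimes> r) [^] Suc k \<otimes> ev (alt_word r s (Suc k))"
      using c Suc.prems by (simp add: m_assoc alt_Suc)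
    finally show ?case .
  qed
  then show ?thesis using assms by blast
qed

lemma ev_braid:
  assumes "r \<in> S" "s \<in> S"
  shows "ev (alt_word s r (cox_m G s r)) = ev (alt_word r s (cox_m G s r))"
proof -
  have "set (alt_word r s k) \<subseteq> S" for k using assms by (auto simp: alt_word_def)
  then show ?thesis
    using ev_alt_word[of r s "cox_m G s r"] assms S_carrier S_square by (simp add: cox_m_def)
qed

text \<open>\<open>s \<otimes> r\<close> and \<open>r \<otimes> s\<close> are mutually inverse. This
  is needed since pairs in \<open>J_phi\<close> are unordered.\<close>

lemma cox_m_commute:
  assumes "r \<in> S" "s \<in> S"
  shows "cox_m G r s = cox_m G s r"
proof -
  have c: "r \<in> carrier G" "s \<in> carrier G" using assms S_carrier by auto
  have "inv r = r" "inv s = s" using S_square assms c by (auto intro: inv_equality)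
  then have "inv (s \<otimes> r) = r \<otimes> s" using c by (simp add: inv_mult_group)
  then show ?thesis using ord_inv[of "s \<otimes> r"] c by (simp add: cox_m_def)
qed

text \<open>\<open>J_cond\<close> holds in one of the two orders, and as both words are reduced
  either order equates the tilings. Either word may be the one known to be reduced because the
  equivalence closure also runs steps backwards.\<close>

lemma J_step_invariant:
  assumes step: "J_braid_step G (J_phi G S n \<phi>) u v" and red: "reduced_word G S u \<or> reduced_word G S v"
  shows "reduced_word G S u \<and> reduced_word G S v \<and> ev u = ev v \<and> tiling G n \<phi> u = tiling G n \<phi> v"
proof -
  obtain x y r s where J: "{r, s} \<in> J_phi G S n \<phi>"
    and u: "u = x @ alt_word s r (cox_m G s r) @ y" and v: "v = x @ alt_word r s (cox_m G s r) @ y"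
    using step by (auto simp: J_braid_step_def)
  have rs: "r \<in> S" "s \<in> S" and cond: "J_cond G S n \<phi> s r \<or> J_cond G S n \<phi> r s"
    using J by (auto simp: J_phi_def doubleton_eq_iff)
  have altS: "set (alt_word s r k) \<subseteq> S" "set (alt_word r s k) \<subseteq> S" for k
    using rs by (auto simp: alt_word_def)
  have "set u \<subseteq> S \<or> set v \<subseteq> S" using red reduced_wordD(1) by blast
  then have xy: "set x \<subseteq> S" "set y \<subseteq> S" unfolding u v by auto
  have ev: "ev u = ev v" unfolding u v using xy altS by (simp add: ev_append ev_braid[OF rs])
  have len: "length u = length v" by (simp add: u v alt_word_def)
  have uv: "set u \<subseteq> S" "set v \<subseteq> S" using xy altS by (auto simp: u v)
  have red': "reduced_word G S u" "reduced_word G S v"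
    using red reduced_same_ev uv ev len by metis+
  have "tiling G n \<phi> u = tiling G n \<phi> v"
    using cond
  proof
    assume "J_cond G S n \<phi> s r"
    then show ?thesis using red'(1) unfolding J_cond_def u v by blast
  next
    assume "J_cond G S n \<phi> r s"
    then show ?thesis using red'(2) unfolding J_cond_def u v cox_m_commute[OF rs] by metis
  qed
  then show ?thesis using red' ev by simp
qed

lemma J_equiv_invariant:
  assumes "J_equiv u v" "reduced_word G S u"
  shows "reduced_word G S v \<and> ev v = ev u \<and> tiling G n \<phi> v = tiling G n \<phi> u"
  using assms
proof (induction rule: equivclp_induct)
  case (step y z)
  then show ?case using J_step_invariant[of y z] J_step_invariant[of z y] by metis
qed simp

text \<open>Induction on \<open>a\<close>: moves that preserve the tiling bring its first letter to
  the front of \<open>b\<close>, where it joins the common prefix. The prefix stays in the statement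
  because the tilings compared are those of whole words.\<close>

lemma same_tiling_imp_J_equiv:
  assumes "reduced_word G S (x @ a)" "reduced_word G S (x @ b)" "ev (x @ a) = ev (x @ b)"
    "tiling G n \<phi> (x @ a) = tiling G n \<phi> (x @ b)"
  shows "J_equiv (x @ a) (x @ b)"
  using assms
proof (induction a arbitrary: x b)
  case Nil
  then have "length (x @ b) = length x" using reduced_wordD(2) by (metis append_Nil2)
  then show ?case by simp
next
  case (Cons s a)
  obtain u v where b: "b = u @ s # v" and ap: "\<forall>q\<in>set u. q \<noteq> s \<and> apart q s"
    using same_tiling_first_letter[OF Cons.prems(1,2,4,3)] by blast
  have eq: "J_equiv (x @ b) (x @ s # u @ v)"
    unfolding b using ap reduced_wordD(1)[OF Cons.prems(2)] by (intro J_equiv_move_front) (auto simp: b)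
  note inv = J_equiv_invariant[OF eq Cons.prems(2)]
  have "J_equiv ((x @ [s]) @ a) ((x @ [s]) @ (u @ v))"
    using Cons.prems inv by (intro Cons.IH) auto
  then have "J_equiv (x @ s # a) (x @ s # u @ v)" by simp
  then show ?case using equivclp_trans equivclp_sym[OF eq] by metis
qed

lemma J_equiv_iff_same_tiling:
  assumes "u \<in> reduced_words G S w" "v \<in> reduced_words G S w"
  shows "J_equiv u v \<longleftrightarrow> tiling G n \<phi> u = tiling G n \<phi> v"
proof -
  have red: "reduced_word G S u" "reduced_word G S v" and ev: "ev u = ev v"
    using assms by (auto simp: reduced_words_def reduced_word_def reduced_word_for_def)
  show ?thesis
    using J_equiv_invariant[OF _ red(1), of v] same_tiling_imp_J_equiv[of "[]" u v] red ev by auto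
qed

end

theorem theorem1p2:
  fixes G :: "('a, 'b) monoid_scheme" and S :: "'a set" and n :: nat
    and \<phi> :: "'a \<Rightarrow> nat \<Rightarrow> nat" and w :: 'a
  assumes "finite_coxeter_system G S"
    and "n \<ge> 2"
    and "E_embedding G S n \<phi>"
    and "w \<in> carrier G"
  shows "\<exists>f. bij_betw f (R_J G S (J_phi G S n \<phi>) w) (tilings G S n \<phi> w) \<and>
             (\<forall>ws \<in> reduced_words G S w.
                f ({(u, v). equivclp (J_braid_step G (J_phi G S n \<phi>)) u v} `` {ws}) = tiling G n \<phi> ws)"
proof -
  interpret e_embedded_coxeter G S n \<phi>
    using assms by (auto simp: e_embedded_coxeter_def e_embedded_coxeter_axioms_def
        finite_coxeter_system_def coxeter_system_def)
  let ?E = "{(u, v). J_equiv u v}"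
  \<comment> \<open>The relation lives on all lists. The reduced words for \<open>w\<close> in the
    class of such a word share one tiling, so the description is proper there.\<close>
  define f where "f C = (THE t. \<exists>v\<in>C \<inter> reduced_words G S w. t = tiling G n \<phi> v)" for C
  have f: "f (?E `` {ws}) = tiling G n \<phi> ws" if "ws \<in> reduced_words G S w" for ws
    unfolding f_def using that J_equiv_iff_same_tiling[OF that] by (intro the_equality) auto
  have cls: "?E `` {u} = ?E `` {v}" if "J_equiv u v" for u v
    using equivclp_trans[OF that] equivclp_trans[OF equivclp_sym[OF that]] by blast
  have "inj_on f (R_J G S (J_phi G S n \<phi>) w)"
  proof (rule inj_onI)
    fix C D assume "C \<in> R_J G S (J_phi G S n \<phi>) w" "D \<in> R_J G S (J_phi G S n \<phi>) w" "f C = f D"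
    then obtain u v where uv: "u \<in> reduced_words G S w" "v \<in> reduced_words G S w"
      and "C = ?E `` {u}" "D = ?E `` {v}" "f (?E `` {u}) = f (?E `` {v})"
      by (auto simp: R_J_def elim!: quotientE)
    then show "C = D" using f cls J_equiv_iff_same_tiling[OF uv] by simp
  qed
  moreover have "f ` R_J G S (J_phi G S n \<phi>) w = tilings G S n \<phi> w"
    using f by (force simp: R_J_def quotient_def tilings_def)
  ultimately show ?thesis using f by (auto simp: bij_betw_def)
qed

end
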